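(* Let $k\in\mathbb N_+$, $\theta\in[-1,1]$, $L=\lceil\frac{k+3}{2}\rceil$, and let $Q$ be an integer with $Q\ge\frac{k+1}{2}$. Then the classic 2D cell average decomposition $$\langle p\rangle_\Omega=\omega_1^{\mathtt{GL}}\big[(1+\theta)\langle p\rangle_\Omega^x+(1-\theta)\langle p\rangle_\Omega^y\big]+\frac{1+\theta}{2}\sum_{\ell=2}^{L-1}\sum_{q=1}^Q\omega_\ell^{\mathtt{GL}}\omega_q^{\mathtt G}\,p(\xi_\ell^{\mathtt{GL}},\xi_q^{\mathtt G})+\frac{1-\theta}{2}\sum_{\ell=2}^{L-1}\sum_{q=1}^Q\omega_\ell^{\mathtt{GL}}\omega_q^{\mathtt G}\,p(\xi_q^{\mathtt G},\xi_\ell^{\mathtt{GL}})$$ is an OCAD for $\mathbb Q^k$ (and this $\theta$), and $$\overline\omega_\star(\theta,\mathbb Q^k)=\phi^\star(\theta,\mathbb Q^k_+)=\phi^\star\big(\theta,(\mathbb Q^{\lfloor k/2\rfloor})^2\big)=\omega_1^{\mathtt{GL}}=\frac1{L(L-1)} .$$ Moreover, there exists a critical positive polynomial for $\phi^\star(\theta,\mathbb Q^k_+)$ of the form $q_\star^2$ with $q_\star\in\mathbb Q^{\lfloor k/2\rfloor}\setminus\{0\}$.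
   Context: $\mathbb Q^k$: real polynomials in $(x,y)$ of degree at most $k$ in each variable. $\Omega=[-1,1]^2$, $\langle p\rangle_\Omega=\frac14\iint_\Omega p$, $\langle p\rangle_\Omega^x=\frac14\int_{-1}^1[p(-1,y)+p(1,y)]dy$, $\langle p\rangle_\Omega^y=\frac14\int_{-1}^1[p(x,-1)+p(x,1)]dx$, $\overline{p(a,b)}=\frac14[p(a,b)+p(-a,b)+p(a,-b)+p(-a,-b)]$. $\{\xi_\ell^{\mathtt{GL}},\omega_\ell^{\mathtt{GL}}\}_{\ell=1}^L$ are the $L$-point Gauss--Lobatto nodes on $[-1,1]$ in increasing order ($\xi_1^{\mathtt{GL}}=-1$, $\xi_L^{\mathtt{GL}}=1$) and weights, and $\{\xi_q^{\mathtt G},\omega_q^{\mathtt G}\}_{q=1}^Q$ are the $Q$-point Gauss(--Legendre) nodes on $[-1,1]$ and weights; both sets of weights are normalized to sum to one. A feasible symmetric CAD for $(\theta,\mathbb V^k)$ with boundary weight $\overline\omega$ is an identity $\langle p\rangle_\Omega=\overline\omega[(1+\theta)\langle p\rangle_\Omega^x+(1-\theta)\langle p\rangle_\Omega^y]+\sum_{s=1}^S\omega_s\overline{p(x^{(s)},y^{(s)})}$ valid for all $p\in\mathbb V^k$, with $S\ge0$ finite, $\overline\omega>0$, all $\omega_s>0$, all $(x^{(s)},y^{(s)})\in[0,1]^2$. (The classic decomposition is of this form after grouping reflected nodes, which carry equal weights.) $\overline\omega_\star(\theta,\mathbb V^k)$ is the maximum of $\overline\omega$ over all such CADs, and an OCAD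 is one attaining it. $\mathbb V^k_+=\{p\in\mathbb V^k:p\ge0\text{ on }\Omega\}$. For $p\in\mathbb V_+^k$, $\phi(p;\theta)=\dfrac{\langle p\rangle_\Omega}{(1+\theta)\langle p\rangle_\Omega^x+(1-\theta)\langle p\rangle_\Omega^y}$ if the denominator is nonzero, $+\infty$ otherwise; $\phi^\star(\theta,\mathbb V^k_+)=\inf_{p\in\mathbb V^k_+}\phi(p;\theta)$ and $\phi^\star(\theta,(\mathbb V^m)^2)=\inf_{q\in\mathbb V^m}\phi(q^2;\theta)$. A critical positive polynomial for $\phi^\star(\theta,\mathbb V^k_+)$ is a $p^\star\in\mathbb V^k_+\setminus\{0\}$ with $\phi(p^\star;\theta)=\phi^\star(\theta,\mathbb V^k_+)$. *)

theory Defs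
  imports "HOL-Analysis.Analysis" "HOL-Computational_Algebra.Polynomial"
begin

text \<open>Elements of \<open>\<real>[x, y]\<close> are identified with their polynomial functions on the plane.\<close>

definition Qspace :: "nat \<Rightarrow> (real \<times> real \<Rightarrow> real) set" where
  "Qspace k = {p. \<exists>c :: nat \<Rightarrow> nat \<Rightarrow> real. \<forall>x y.
     p (x, y) = (\<Sum>i\<le>k. \<Sum>j\<le>k. c i j * x ^ i * y ^ j)}"

definition Omega :: "(real \<times> real) set" where
  "Omega = {-1..1} \<times> {-1..1}"

definition avg :: "(real \<times> real \<Rightarrow> real) \<Rightarrow> real" where
  "avg p = 1/4 * integral Omega p"

definition avg_x :: "(real \<times> real \<Rightarrow> real) \<Rightarrow> real" where
  "avg_x p = 1/4 * integral {-1..1} (\<lambda>y. p (-1, y) + p (1, y))"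

definition avg_y :: "(real \<times> real \<Rightarrow> real) \<Rightarrow> real" where
  "avg_y p = 1/4 * integral {-1..1} (\<lambda>x. p (x, -1) + p (x, 1))"

definition bdry_avg :: "real \<Rightarrow> (real \<times> real \<Rightarrow> real) \<Rightarrow> real" where
  "bdry_avg \<theta> p = (1 + \<theta>) * avg_x p + (1 - \<theta>) * avg_y p"

definition sym_avg :: "(real \<times> real \<Rightarrow> real) \<Rightarrow> real \<times> real \<Rightarrow> real" where
  "sym_avg p = (\<lambda>(a, b). 1/4 * (p (a, b) + p (-a, b) + p (a, -b) + p (-a, -b)))"


text \<open>Legendre polynomials, by Rodrigues' formula.\<close>

definition legendre :: "nat \<Rightarrow> real poly" where
  "legendre n = smult (1 / (2 ^ n * fact n)) ((pderiv ^^ n) ([:-1, 0, 1:] ^ n))"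

text \<open>Nodes are numbered from 1 in increasing order. The \<open>n\<close> Gauss nodes are the zeros of
  the Legendre polynomial \<open>P\<^sub>n\<close>; the \<open>n\<close> Gauss--Lobatto nodes (\<open>n \<ge> 2\<close>) are the zeros of
  \<open>(1 - x\<^sup>2) P'\<^sub>n\<^sub>-\<^sub>1(x)\<close>, that is, the endpoints \<open>\<plusminus>1\<close> and the zeros of \<open>P'\<^sub>n\<^sub>-\<^sub>1\<close>.\<close>

definition G_node :: "nat \<Rightarrow> nat \<Rightarrow> real" where
  "G_node n i = sorted_list_of_set {x. poly (legendre n) x = 0} ! (i - 1)"

definition GL_node :: "nat \<Rightarrow> nat \<Rightarrow> real" where
  "GL_node n i =
     sorted_list_of_set {x. poly ([:1, 0, -1:] * pderiv (legendre (n - 1))) x = 0} ! (i - 1)"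

text \<open>The weight of a node is the mean over \<open>[-1, 1]\<close> of its Lagrange basis polynomial. The
  factor \<open>1/2\<close> is what normalizes the weights of a rule to sum to one.\<close>

definition quad_weight :: "nat \<Rightarrow> (nat \<Rightarrow> real) \<Rightarrow> nat \<Rightarrow> real" where
  "quad_weight n \<xi> i =
     1/2 * integral {-1..1} (\<lambda>x. \<Prod>j\<in>{1..n} - {i}. (x - \<xi> j) / (\<xi> i - \<xi> j))"

definition G_weight :: "nat \<Rightarrow> nat \<Rightarrow> real" where
  "G_weight n = quad_weight n (G_node n)"

definition GL_weight :: "nat \<Rightarrow> nat \<Rightarrow> real" where
  "GL_weight n = quad_weight n (GL_node n)"


definition symmetric_cad ::
  "real \<Rightarrow> (real \<times> real \<Rightarrow> real) set \<Rightarrow> real \<Rightarrow> nat \<Rightarrow> (nat \<Rightarrow> real) \<Rightarrow> (nat \<Rightarrow> real \<times> real) \<Rightarrow> bool"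
  where
  "symmetric_cad \<theta> V \<omega>b S \<omega> z \<longleftrightarrow>
     \<omega>b > 0 \<and> (\<forall>s\<in>{1..S}. \<omega> s > 0 \<and> z s \<in> {0..1} \<times> {0..1}) \<and>
     (\<forall>p\<in>V. avg p = \<omega>b * bdry_avg \<theta> p + (\<Sum>s=1..S. \<omega> s * sym_avg p (z s)))"

definition ocad ::
  "real \<Rightarrow> (real \<times> real \<Rightarrow> real) set \<Rightarrow> real \<Rightarrow> nat \<Rightarrow> (nat \<Rightarrow> real) \<Rightarrow> (nat \<Rightarrow> real \<times> real) \<Rightarrow> bool"
  where
  "ocad \<theta> V \<omega>b S \<omega> z \<longleftrightarrow>
     symmetric_cad \<theta> V \<omega>b S \<omega> z \<and>
     (\<forall>\<omega>b' S' \<omega>' z'. symmetric_cad \<theta> V \<omega>b' S' \<omega>' z' \<longrightarrow> \<omega>b' \<le> \<omega>b)"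

text \<open>The maximal boundary weight; the value is unspecified if the maximum is not attained,
  so an equation for it carries information only together with the existence of an OCAD.\<close>

definition omega_star :: "real \<Rightarrow> (real \<times> real \<Rightarrow> real) set \<Rightarrow> real" where
  "omega_star \<theta> V = (GREATEST \<omega>b. \<exists>S \<omega> z. symmetric_cad \<theta> V \<omega>b S \<omega> z)"

definition classic_interior :: "real \<Rightarrow> nat \<Rightarrow> nat \<Rightarrow> (real \<times> real \<Rightarrow> real) \<Rightarrow> real" where
  "classic_interior \<theta> L Q p =
     (1 + \<theta>) / 2 * (\<Sum>l=2..L-1. \<Sum>q=1..Q. GL_weight L l * G_weight Q q * p (GL_node L l, G_node Q q)) +
     (1 - \<theta>) / 2 * (\<Sum>l=2..L-1. \<Sum>q=1..Q. GL_weight L l * G_weight Q q * p (G_node Q q, GL_node L l))"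

text \<open>A decomposition with boundary weight \<open>\<omega>b\<close> and interior part \<open>I\<close>, a weighted sum of point
  evaluations whose nodes need not be grouped, is an OCAD if grouping reflected nodes turns it
  into one. Finite weighted sums of point evaluations that agree on \<^emph>\<open>all\<close> functions have the
  same nodes and total weights, so the equation below says exactly that the symmetric CAD is a
  regrouping of \<open>I\<close>.\<close>

definition ocad_after_grouping ::
  "real \<Rightarrow> (real \<times> real \<Rightarrow> real) set \<Rightarrow> real \<Rightarrow> ((real \<times> real \<Rightarrow> real) \<Rightarrow> real) \<Rightarrow> bool" where
  "ocad_after_grouping \<theta> V \<omega>b I \<longleftrightarrow>
     (\<exists>S \<omega> z. (\<forall>f. I f = (\<Sum>s=1..S. \<omega> s * sym_avg f (z s))) \<and> ocad \<theta> V \<omega>b S \<omega> z)"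


definition nonneg_part :: "(real \<times> real \<Rightarrow> real) set \<Rightarrow> (real \<times> real \<Rightarrow> real) set" where
  "nonneg_part V = {p \<in> V. \<forall>z\<in>Omega. p z \<ge> 0}"

definition phi :: "real \<Rightarrow> (real \<times> real \<Rightarrow> real) \<Rightarrow> ereal" where
  "phi \<theta> p = (if bdry_avg \<theta> p \<noteq> 0 then ereal (avg p / bdry_avg \<theta> p) else \<infinity>)"

definition phi_star :: "real \<Rightarrow> (real \<times> real \<Rightarrow> real) set \<Rightarrow> ereal" where
  "phi_star \<theta> P = (INF p\<in>P. phi \<theta> p)"

definition squares :: "(real \<times> real \<Rightarrow> real) set \<Rightarrow> (real \<times> real \<Rightarrow> real) set" where
  "squares V = (\<lambda>q z. (q z)\<^sup>2) ` V"

definition critical_positive ::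
  "real \<Rightarrow> (real \<times> real \<Rightarrow> real) set \<Rightarrow> (real \<times> real \<Rightarrow> real) \<Rightarrow> bool" where
  "critical_positive \<theta> V p \<longleftrightarrow>
     p \<in> nonneg_part V \<and> p \<noteq> (\<lambda>_. 0) \<and> phi \<theta> p = phi_star \<theta> (nonneg_part V)"

end

theory Submission
  imports Defs
begin

text \<open>
  With \<open>L = \<lfloor>k/2\<rfloor> + 2\<close> the Gauss--Lobatto rule is exact in degree \<open>2 L - 3 \<ge> k\<close>, and the Gauss rule
  is exact in degree \<open>2 Q - 1 \<ge> k\<close>. Applying the former in \<open>x\<close> and the latter in \<open>y\<close> (and the other
  way round) and combining the two identities with weights \<open>(1 \<plusminus> \<theta>)/2\<close> gives the classic
  decomposition. As its interior part is nonnegative, \<open>\<phi>(p; \<theta>) \<ge> \<omega>\<^sub>1\<close> for every nonnegative \<open>p\<close>. On the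
  other hand any decomposition with boundary weight \<open>\<omega>\<close> gives \<open>\<omega> \<le> \<phi>(p; \<theta>)\<close>. The bounds meet at
  \<open>p = q\<^sup>2\<close> with \<open>q(x, y) = P'\<^sub>L\<^sub>-\<^sub>1(x) P'\<^sub>L\<^sub>-\<^sub>1(y)\<close>, since \<open>P'\<^sub>L\<^sub>-\<^sub>1\<close> vanishes at the interior
  Gauss--Lobatto nodes and one coordinate of every interior node is of this kind.
\<close>

subsection \<open>Interpolatory quadrature on \<open>[-1, 1]\<close>\<close>

text \<open>The average is taken on polynomials, not on functions, so that degrees, division with
  remainder and \<open>pderiv\<close> are at hand; the factor \<open>1/2\<close> is that of
  \<open>quad_weight\<close>.\<close>

definition mean :: "real poly \<Rightarrow> real" where
  "mean p = 1/2 * integral {-1..1} (poly p)"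

lemma poly_integrable: "poly p integrable_on {a..b::real}"
  by (intro integrable_continuous_real continuous_intros)

lemma mean_0: "mean 0 = 0"
proof -
  have "poly (0::real poly) = (\<lambda>_. 0)" by auto
  then show ?thesis by (simp add: mean_def)
qed

lemma mean_add: "mean (p + q) = mean p + mean q"
  unfolding mean_def poly_add by (simp add: integral_add poly_integrable algebra_simps)

lemma mean_smult: "mean (smult c p) = c * mean p"
  unfolding mean_def poly_smult by simp

lemma mean_sum: "mean (\<Sum>i\<in>A. f i) = (\<Sum>i\<in>A. mean (f i))"
proof (cases "finite A")
  case True
  then show ?thesis
    by (induction A) (auto simp: mean_add mean_0)
qed (auto simp: mean_0)

lemma mean_pderiv: "mean (pderiv p) = (poly p 1 - poly p (-1)) / 2"
proof -
  have "(poly (pderiv p) has_integral poly p 1 - poly p (-1)) {-1..1}"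
    by (rule fundamental_theorem_of_calculus)
       (auto simp flip: has_real_derivative_iff_has_vector_derivative
             intro: DERIV_subset[OF poly_DERIV])
  then show ?thesis
    by (simp add: mean_def integral_unique)
qed

lemma mean_by_parts:
  "mean (pderiv p * q) =
     (poly p 1 * poly q 1 - poly p (-1) * poly q (-1)) / 2 - mean (p * pderiv q)"
  using mean_pderiv[of "p * q"] by (simp add: pderiv_mult mean_add mult.commute field_simps)

lemma mean_reflect: "mean (p \<circ>\<^sub>p [:0, -1:]) = mean p"
proof -
  have "integral {- 1..- (- 1)} (\<lambda>x. poly p (- x)) = integral {-1..1::real} (poly p)"
    by (rule Henstock_Kurzweil_Integration.integral_reflect_real)
  then show ?thesis
    by (simp add: mean_def poly_pcompose[abs_def])
qed

text \<open>A continuous nonnegative function with integral zero vanishes on all of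
  \<open>[-1, 1]\<close>, and a nonzero polynomial has only finitely many zeros.\<close>

lemma mean_pos:
  assumes "\<And>x. x \<in> {-1..1} \<Longrightarrow> poly p x \<ge> 0" and "p \<noteq> 0"
  shows "mean p > 0"
proof -
  have "integral {-1..1} (poly p) \<noteq> 0"
  proof
    assume "integral {-1..1} (poly p) = 0"
    then have "\<forall>x\<in>{-1..1}. poly p x = 0"
      using integral_eq_0_iff[of "-1" 1 "poly p"] assms(1) by (auto simp: continuous_on_poly)
    then have "{-1..1} \<subseteq> {x. poly p x = 0}"
      by auto
    then have "finite {-1..1::real}"
      using poly_roots_finite[OF \<open>p \<noteq> 0\<close>] finite_subset by blast
    then show False
      using infinite_Icc[of "-1" "1::real"] by simp
  qed
  moreover have "integral {-1..1} (poly p) \<ge> 0"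
    by (intro integral_nonneg poly_integrable assms(1))
  ultimately show ?thesis
    by (simp add: mean_def)
qed

text \<open>The integrand of \<open>quad_weight\<close> as a polynomial, which gives it a
  degree.\<close>

definition lagrange :: "nat \<Rightarrow> (nat \<Rightarrow> real) \<Rightarrow> nat \<Rightarrow> real poly" where
  "lagrange n \<xi> i = (\<Prod>j\<in>{1..n} - {i}. smult (1 / (\<xi> i - \<xi> j)) [:- \<xi> j, 1:])"

lemma poly_lagrange: "poly (lagrange n \<xi> i) x = (\<Prod>j\<in>{1..n} - {i}. (x - \<xi> j) / (\<xi> i - \<xi> j))"
  by (simp add: lagrange_def poly_prod diff_divide_distrib add_divide_distrib)

lemma quad_weight_eq_mean: "quad_weight n \<xi> i = mean (lagrange n \<xi> i)"
  unfolding quad_weight_def mean_def poly_lagrange[abs_def] ..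

lemma degree_lagrange:
  assumes "i \<in> {1..n}"
  shows "degree (lagrange n \<xi> i) \<le> n - 1"
proof -
  have "degree (lagrange n \<xi> i) \<le> (\<Sum>j\<in>{1..n} - {i}. 1)"
    unfolding lagrange_def by (intro order.trans[OF degree_prod_sum_le] sum_mono) auto
  then show ?thesis
    using assms by simp
qed

lemma poly_lagrange_node:
  assumes "inj_on \<xi> {1..n}" "i \<in> {1..n}" "j \<in> {1..n}"
  shows "poly (lagrange n \<xi> i) (\<xi> j) = (if j = i then 1 else 0)"
proof (cases "j = i")
  case True
  have "\<xi> i \<noteq> \<xi> l" if "l \<in> {1..n} - {i}" for l
    using that assms(1,2) by (metis DiffD1 DiffD2 inj_onD singletonI)
  then show ?thesis
    unfolding poly_lagrange True by (auto intro!: prod.neutral)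
next
  case False
  then have "j \<in> {1..n} - {i}" using assms by auto
  then have "(\<Prod>l\<in>{1..n} - {i}. (\<xi> j - \<xi> l) / (\<xi> i - \<xi> l)) = 0"
    by (intro prod_zero bexI[of _ j]) auto
  then show ?thesis
    using False by (simp add: poly_lagrange)
qed

lemma poly_eq_of_agree:
  fixes p q :: "real poly"
  assumes "inj_on \<xi> {1..n}" "degree p < n" "degree q < n"
    and "\<And>i. i \<in> {1..n} \<Longrightarrow> poly p (\<xi> i) = poly q (\<xi> i)"
  shows "p = q"
proof (rule ccontr)
  assume "p \<noteq> q"
  then have ne: "p - q \<noteq> 0" by simp
  have "n = card (\<xi> ` {1..n})"
    using assms(1) by (simp add: card_image)
  also have "\<dots> \<le> card {x. poly (p - q) x = 0}"
    by (intro card_mono poly_roots_finite ne) (use assms(4) in auto)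
  also have "\<dots> \<le> degree (p - q)"
    by (rule card_poly_roots_bound[OF ne])
  also have "\<dots> < n"
    using assms(2,3) by (metis degree_diff_less)
  finally show False by simp
qed

text \<open>A polynomial of degree below \<open>n\<close> is its own Lagrange interpolant
  \<open>r\<close>, and the mean of \<open>r\<close> is the weighted sum because the weights are the
  means of the basis polynomials.\<close>

lemma interpolatory_exact:
  assumes "inj_on \<xi> {1..n}" "degree p < n"
  shows "mean p = (\<Sum>i=1..n. quad_weight n \<xi> i * poly p (\<xi> i))"
proof -
  define r where "r = (\<Sum>i=1..n. smult (poly p (\<xi> i)) (lagrange n \<xi> i))"
  have "degree r \<le> n - 1"
    unfolding r_def
    using degree_lagrange by (intro degree_sum_le) (auto intro!: order.trans[OF degree_smult_le])
  then have "degree r < n"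
    using assms(2) by linarith
  moreover have "poly r (\<xi> j) = poly p (\<xi> j)" if "j \<in> {1..n}" for j
  proof -
    have "poly r (\<xi> j) = (\<Sum>i=1..n. if j = i then poly p (\<xi> i) else 0)"
      unfolding r_def poly_sum using that assms(1)
      by (intro sum.cong) (auto simp: poly_lagrange_node)
    then show ?thesis using that by simp
  qed
  ultimately have "p = r"
    by (intro poly_eq_of_agree[OF assms]) auto
  then have "mean p = mean r" by simp
  then show ?thesis
    by (simp add: r_def mean_sum mean_smult quad_weight_eq_mean mult.commute)
qed

text \<open>Divide \<open>p\<close> by the nodal polynomial \<open>W\<close>. The quotient has
  degree below \<open>m\<close> and is killed by orthogonality; the remainder has degree below
  \<open>n\<close> and agrees with \<open>p\<close> at the nodes. Gauss is the case
  \<open>m = n\<close>, Gauss--Lobatto the case \<open>m = n - 2\<close>.\<close>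

lemma quadrature_exact:
  assumes "inj_on \<xi> {1..n}" "degree W = n" "n > 0"
    and root: "\<And>i. i \<in> {1..n} \<Longrightarrow> poly W (\<xi> i) = 0"
    and orth: "\<And>g. degree g < m \<Longrightarrow> mean (W * g) = 0"
    and "degree p < n + m"
  shows "mean p = (\<Sum>i=1..n. quad_weight n \<xi> i * poly p (\<xi> i))"
proof -
  have "W \<noteq> 0" using assms(2,3) by auto
  have p: "p = W * (p div W) + p mod W" by simp
  have deg: "degree (p mod W) < n"
    using degree_mod_less[OF \<open>W \<noteq> 0\<close>, of p] assms(2,3) by auto
  have "mean (W * (p div W)) = 0"
  \<comment> \<open>For \<open>m = 0\<close>, the two-point Gauss--Lobatto rule, no \<open>g\<close>
    satisfies \<open>degree g < m\<close>, so a zero quotient is outside the scope of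
    \<open>orth\<close>.\<close>
  proof (cases "p div W = 0")
    case False
    have "n + degree (p div W) = degree (W * (p div W))"
      using False \<open>W \<noteq> 0\<close> assms(2) by (simp add: degree_mult_eq)
    also have "W * (p div W) = p - p mod W"
      by (simp add: minus_mod_eq_mult_div)
    also have "degree \<dots> < n + m"
      using deg assms(6) by (intro degree_diff_less) auto
    finally show ?thesis by (intro orth) simp
  qed (simp add: mean_0)
  then have "mean p = mean (p mod W)"
    using p mean_add[of "W * (p div W)" "p mod W"] by simp
  also have "\<dots> = (\<Sum>i=1..n. quad_weight n \<xi> i * poly (p mod W) (\<xi> i))"
    by (rule interpolatory_exact) (use assms(1) deg in auto)
  also have "\<dots> = (\<Sum>i=1..n. quad_weight n \<xi> i * poly p (\<xi> i))"
  proof (intro sum.cong refl)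
    fix i assume "i \<in> {1..n}"
    then have "poly p (\<xi> i) = poly (p mod W) (\<xi> i)"
      using root[of i] by (metis p add_0 mult_zero_left poly_add poly_mult)
    then show "quad_weight n \<xi> i * poly (p mod W) (\<xi> i) = quad_weight n \<xi> i * poly p (\<xi> i)"
      by simp
  qed
  finally show ?thesis .
qed

text \<open>The mirrored basis polynomial \<open>r\<close> has the same mean. At the nodes it is 1
  at index \<open>n + 1 - i\<close> and 0 elsewhere, so the rule applied to \<open>r\<close> returns
  the weight of the mirrored node.\<close>

lemma quad_weight_reflect:
  assumes "inj_on \<xi> {1..n}" "i \<in> {1..n}"
    and sym: "\<And>j. j \<in> {1..n} \<Longrightarrow> \<xi> (n + 1 - j) = - \<xi> j"
  shows "quad_weight n \<xi> (n + 1 - i) = quad_weight n \<xi> i"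
proof -
  define r where "r = lagrange n \<xi> i \<circ>\<^sub>p [:0, -1:]"
  have "degree r \<le> n - 1"
    using degree_lagrange[OF assms(2)] by (simp add: r_def degree_pcompose)
  then have "degree r < n" using assms(2) by auto
  have "quad_weight n \<xi> i = mean r"
    by (simp add: r_def mean_reflect quad_weight_eq_mean)
  also have "\<dots> = (\<Sum>j=1..n. quad_weight n \<xi> j * poly r (\<xi> j))"
    by (rule interpolatory_exact[OF assms(1) \<open>degree r < n\<close>])
  also have "\<dots> = (\<Sum>j=1..n. if j = n + 1 - i then quad_weight n \<xi> j else 0)"
  proof (intro sum.cong refl)
    fix j assume j: "j \<in> {1..n}"
    then have "poly r (\<xi> j) = poly (lagrange n \<xi> i) (\<xi> (n + 1 - j))"
      using sym[of j] by (simp add: r_def poly_pcompose)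
    also have "\<dots> = (if n + 1 - j = i then 1 else 0)"
      using j assms(2) by (intro poly_lagrange_node[OF assms(1)]) auto
    also have "(n + 1 - j = i) = (j = n + 1 - i)"
      using j assms(2) by auto
    finally show "quad_weight n \<xi> j * poly r (\<xi> j) = (if j = n + 1 - i then quad_weight n \<xi> j else 0)"
      by simp
  qed
  also have "\<dots> = quad_weight n \<xi> (n + 1 - i)"
    using assms(2) by auto
  finally show ?thesis by simp
qed

section \<open>Zeros listed in increasing order\<close>

lemma bij_betw_sorted_nodes:
  fixes R :: "real set"
  assumes "finite R"
  shows "bij_betw (\<lambda>i. sorted_list_of_set R ! (i - 1)) {1..card R} R"
proof -
  have "bij_betw (\<lambda>i. i - 1) {1..card R} {..<card R}"
    by (rule bij_betw_byWitness[where f' = Suc]) auto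
  moreover have "bij_betw (\<lambda>i. sorted_list_of_set R ! i) {..<card R} R"
    using bij_betw_nth[of "sorted_list_of_set R" "{..<card R}" R] assms by simp
  ultimately show ?thesis
    using bij_betw_trans[of "\<lambda>i. i - 1" _ _ "\<lambda>i. sorted_list_of_set R ! i"] by (simp add: comp_def)
qed

text \<open>Negating and reversing the sorted list of a symmetric set gives a sorted distinct list
  of the same set, hence the same list.\<close>

lemma sorted_nodes_reflect:
  fixes R :: "real set"
  assumes "finite R" "uminus ` R = R" "i \<in> {1..card R}"
  shows "sorted_list_of_set R ! (card R + 1 - i - 1) = - (sorted_list_of_set R ! (i - 1))"
proof -
  define xs where "xs = sorted_list_of_set R"
  have len: "length xs = card R" by (simp add: xs_def)
  have "rev (map uminus xs) = xs"
  proof (rule sorted_distinct_set_unique)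
    show "sorted (rev (map uminus xs))"
      by (simp add: sorted_wrt_rev sorted_wrt_map xs_def)
  qed (use assms in \<open>auto simp: xs_def distinct_map inj_on_def\<close>)
  then have "xs ! (card R - i) = rev (map uminus xs) ! (card R - i)" by simp
  also have "\<dots> = - (xs ! (i - 1))"
    using assms(3) len by (subst rev_nth) auto
  finally show ?thesis by (simp add: xs_def)
qed

subsection \<open>Legendre polynomials\<close>

text \<open>Rolle's theorem between consecutive zeros, by induction on adding a new maximum
  \<open>b\<close>. Confining \<open>B\<close> to the open range of \<open>A\<close> makes the zero
  found between \<open>Max A\<close> and \<open>b\<close> a new one.\<close>

lemma rolle_count:
  fixes p :: "real poly"
  assumes "finite A" "A \<noteq> {}" "\<And>x. x \<in> A \<Longrightarrow> poly p x = 0"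
  shows "\<exists>B. finite B \<and> Suc (card B) = card A \<and> B \<subseteq> {Min A<..<Max A} \<and> (\<forall>x\<in>B. poly (pderiv p) x = 0)"
  using assms
proof (induction A rule: finite_linorder_max_induct)
  case empty
  then show ?case by simp
next
  case (insert b A)
  show ?case
  proof (cases "A = {}")
    case True
    then show ?thesis by (intro exI[of _ "{}"]) auto
  next
    case False
    then obtain B where B: "finite B" "Suc (card B) = card A" "B \<subseteq> {Min A<..<Max A}"
        "\<forall>x\<in>B. poly (pderiv p) x = 0"
      using insert by auto
    have MA: "Max A \<in> A" "Max A < b" "Min A \<le> Max A"
      using insert False by auto
    then have "\<exists>z>Max A. z < b \<and> poly (pderiv p) z = 0"
      using insert.prems poly_MVT[of "Max A" b p] by auto
    then obtain z where z: "Max A < z" "z < b" "poly (pderiv p) z = 0" by auto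
    have mm: "Min (insert b A) = Min A" "Max (insert b A) = b"
      using insert.hyps False MA
      by (auto simp: min_absorb2 max_absorb1)
    have "z \<notin> B" "b \<notin> A" using B z insert by auto
    then show ?thesis
      using B z MA mm insert.hyps order.strict_trans1[OF MA(3) z(1)] by (intro exI[of _ "insert z B"]) auto
  qed
qed

lemma power_dvd_pderiv:
  fixes a p :: "real poly"
  assumes "a ^ Suc m dvd p"
  shows "a ^ m dvd pderiv p"
proof -
  obtain q where "p = a ^ Suc m * q" using assms by (rule dvdE)
  then have "pderiv p = a ^ m * (a * pderiv q + smult (of_nat (Suc m)) (q * pderiv a))"
    by (simp add: pderiv_mult pderiv_power_Suc algebra_simps del: power_Suc) (simp add: algebra_simps)
  then show ?thesis by simp
qed

lemma power_dvd_higher_pderiv: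
  fixes a p :: "real poly"
  assumes "a ^ (j + m) dvd p"
  shows "a ^ m dvd (pderiv ^^ j) p"
  using assms
proof (induction j arbitrary: m)
  case (Suc j)
  then have "a ^ Suc m dvd (pderiv ^^ j) p"
    by (metis add_Suc_shift)
  then show ?case using power_dvd_pderiv by simp
qed simp

text \<open>Each differentiation costs at most one factor \<open>x^2 - 1\<close>, so at least one is
  left after fewer than \<open>n\<close> of them.\<close>

lemma rodrigues_boundary:
  fixes x :: real
  assumes "j < n" "x \<in> {-1, 1}"
  shows "poly ((pderiv ^^ j) ([:-1, 0, 1:] ^ n)) x = 0"
proof -
  have "[:-1, 0, 1:] ^ (j + 1) dvd ([:-1, 0, 1:] ^ n :: real poly)"
    using assms(1) by (intro le_imp_power_dvd) simp
  then have "[:-1, 0, 1:] dvd (pderiv ^^ j) ([:-1, 0, 1:] ^ n :: real poly)"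
    using power_dvd_higher_pderiv[of "[:-1,0,1:]" j 1] by simp
  then show ?thesis using assms(2) by (auto elim!: dvdE)
qed

text \<open>Induction on \<open>j\<close>: while \<open>j < n\<close>, the endpoints join the
  \<open>j\<close> interior zeros, and Rolle's theorem turns these \<open>j + 2\<close> zeros into
  \<open>j + 1\<close> interior zeros of the next derivative.\<close>

lemma rodrigues_roots:
  assumes "j \<le> n"
  shows "\<exists>B\<subseteq>{-1<..<1::real}. finite B \<and> card B = j \<and> (\<forall>x\<in>B. poly ((pderiv ^^ j) ([:-1, 0, 1:] ^ n)) x = 0)"
  using assms
proof (induction j)
  case (Suc j)
  then obtain B where B: "B\<subseteq>{-1<..<1::real}" "finite B" "card B = j"
     "\<forall>x\<in>B. poly ((pderiv ^^ j) ([:-1, 0, 1:] ^ n)) x = 0" by auto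
  define A where "A = insert (-1) (insert 1 B)"
  have "1 \<notin> B" "-1 \<notin> B" using B(1) by auto
  then have A: "card A = j + 2" "finite A" "A \<noteq> {}"
    using B by (auto simp: A_def)
  have mm: "Min A = -1" "Max A = 1"
    using A(2) B(1) by (intro Min_eqI Max_eqI; force simp: A_def)+
  have "poly ((pderiv ^^ j) ([:-1, 0, 1:] ^ n)) x = 0" if "x \<in> A" for x
    using that B(4) rodrigues_boundary[of j n x] Suc.prems by (auto simp: A_def)
  from rolle_count[OF A(2,3) this] A mm show ?case by auto
qed auto

lemma degree_legendre: "degree (legendre n) = n"
  by (simp add: legendre_def degree_higher_pderiv degree_power_eq)

lemma legendre_neq_0: "legendre n \<noteq> 0"
proof (cases "n = 0")
  case True
  then show ?thesis by (simp add: legendre_def)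
next
  case False
  then show ?thesis using degree_legendre[of n] by fastforce
qed

lemma roots_eqI:
  fixes p :: "real poly"
  assumes "p \<noteq> 0" "card B = degree p" "finite B" "\<And>x. x \<in> B \<Longrightarrow> poly p x = 0"
  shows "{x. poly p x = 0} = B"
proof (rule card_seteq[symmetric])
  show "card {x. poly p x = 0} \<le> card B"
    using card_poly_roots_bound[OF assms(1)] assms(2) by simp
qed (use assms poly_roots_finite in auto)

lemma legendre_roots:
  shows "{x. poly (legendre n) x = 0} \<subseteq> {-1<..<1}" and "card {x. poly (legendre n) x = 0} = n"
proof -
  obtain B where B: "B\<subseteq>{-1<..<1::real}" "finite B" "card B = n"
     "\<forall>x\<in>B. poly ((pderiv ^^ n) ([:-1, 0, 1:] ^ n)) x = 0"
    using rodrigues_roots[of n n] by auto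
  have "{x. poly (legendre n) x = 0} = B"
    using B by (intro roots_eqI legendre_neq_0) (auto simp: degree_legendre, simp add: legendre_def)
  then show "{x. poly (legendre n) x = 0} \<subseteq> {-1<..<1}" "card {x. poly (legendre n) x = 0} = n"
    using B by auto
qed

lemma pderiv_legendre_neq_0: "n > 0 \<Longrightarrow> pderiv (legendre n) \<noteq> 0"
  using degree_legendre[of n] by (simp add: pderiv_eq_0_iff)

text \<open>Rolle's theorem between the \<open>n\<close> zeros of \<open>legendre n\<close> gives
  \<open>n - 1\<close> zeros, as many as the degree allows.\<close>

lemma pderiv_legendre_roots:
  assumes "n > 0"
  shows "{x. poly (pderiv (legendre n)) x = 0} \<subseteq> {-1<..<1}"
    and "card {x. poly (pderiv (legendre n)) x = 0} = n - 1"
proof -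
  let ?A = "{x. poly (legendre n) x = 0}"
  have A: "finite ?A" "?A \<noteq> {}"
    using poly_roots_finite[OF legendre_neq_0] legendre_roots(2)[of n] assms
    by (blast, metis card.empty less_numeral_extra(3))
  obtain B where B: "finite B" "Suc (card B) = n" "B \<subseteq> {Min ?A<..<Max ?A}"
       "\<forall>x\<in>B. poly (pderiv (legendre n)) x = 0"
    using rolle_count[OF A, of "legendre n"] unfolding legendre_roots(2) by blast
  have "Min ?A \<in> ?A" "Max ?A \<in> ?A" using A Min_in Max_in by blast+
  then have "B \<subseteq> {-1<..<1}" using B(3) legendre_roots(1)[of n] by fastforce
  moreover have "{x. poly (pderiv (legendre n)) x = 0} = B"
    using B by (intro roots_eqI pderiv_legendre_neq_0 assms) (auto simp: degree_pderiv degree_legendre)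
  ultimately show "{x. poly (pderiv (legendre n)) x = 0} \<subseteq> {-1<..<1}"
     "card {x. poly (pderiv (legendre n)) x = 0} = n - 1" using B by auto
qed

text \<open>Repeated integration by parts, with vanishing boundary terms, moves the derivatives onto
  \<open>g\<close>. The alternative \<open>g = 0\<close> carries the induction down to
  \<open>n = 0\<close>, where no degree is small enough.\<close>

lemma orthogonal_higher_pderiv:
  assumes "\<And>j x. j < n \<Longrightarrow> x \<in> {-1, 1} \<Longrightarrow> poly ((pderiv ^^ j) u) x = 0" and "degree g < n \<or> g = 0"
  shows "mean ((pderiv ^^ n) u * g) = 0"
  using assms
proof (induction n arbitrary: g)
  case 0
  then show ?case by (simp add: mean_0)
next
  case (Suc n)
  have "degree (pderiv g) < n \<or> pderiv g = 0"
    using Suc.prems(2) by (cases "degree g") (auto simp: degree_pderiv pderiv_eq_0_iff)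
  then have "mean ((pderiv ^^ n) u * pderiv g) = 0"
    by (intro Suc.IH Suc.prems(1)) auto
  then show ?case
    using mean_by_parts[of "(pderiv ^^ n) u" g] Suc.prems(1)[of n] by simp
qed

lemma legendre_orthogonal: "degree g < n \<Longrightarrow> mean (legendre n * g) = 0"
  using orthogonal_higher_pderiv[of n "[:-1, 0, 1:] ^ n" g] rodrigues_boundary
  by (simp add: legendre_def mean_smult)

text \<open>Even or odd up to an unspecified nonzero factor \<open>s\<close>: enough for a symmetric
  zero set, and no sign has to be tracked through derivatives and products.\<close>

definition has_parity :: "real poly \<Rightarrow> bool" where
  "has_parity p \<longleftrightarrow> (\<exists>s. s \<noteq> 0 \<and> p \<circ>\<^sub>p [:0, -1:] = smult s p)"

lemma has_parity_pderiv: "has_parity p \<Longrightarrow> has_parity (pderiv p)"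
proof -
  assume "has_parity p"
  then obtain s where s: "s \<noteq> 0" "p \<circ>\<^sub>p [:0, -1:] = smult s p" by (auto simp: has_parity_def)
  have "pderiv (p \<circ>\<^sub>p [:0, -1:]) = pderiv (smult s p)" using s by simp
  then have "pderiv p \<circ>\<^sub>p [:0, -1:] = smult (-s) (pderiv p)"
    by (simp add: pderiv_pcompose pderiv_smult pderiv_pCons)
  then show ?thesis using s unfolding has_parity_def by (intro exI[of _ "-s"]) auto
qed

lemma has_parity_mult: "has_parity p \<Longrightarrow> has_parity q \<Longrightarrow> has_parity (p * q)"
  unfolding has_parity_def pcompose_mult
  by (elim exE conjE, rename_tac s t, rule_tac x = "s * t" in exI) (simp add: ac_simps)

lemma has_parity_legendre: "has_parity (legendre n)"
proof -
  have "has_parity ([:-1, 0, 1:] ^ n)"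
  proof (induction n)
    case 0
    then show ?case by (auto simp: has_parity_def pcompose_1 intro!: exI[of _ 1])
  next
    case (Suc n)
    have "has_parity [:-1, 0, 1:]"
      by (auto simp: has_parity_def pcompose_pCons intro!: exI[of _ 1])
    then show ?case unfolding power_Suc using Suc by (rule has_parity_mult)
  qed
  then have *: "has_parity ((pderiv ^^ j) ([:-1, 0, 1:] ^ n))" for j
    by (induction j) (auto intro: has_parity_pderiv)
  have "has_parity (smult c p)" if "has_parity p" for c p
    using that by (auto simp: has_parity_def pcompose_smult mult.commute)
  then show ?thesis using * unfolding legendre_def by blast
qed

lemma has_parity_roots:
  assumes "has_parity p"
  shows "uminus ` {x. poly p x = 0} = {x. poly p x = 0}"
proof -
  obtain s where s: "s \<noteq> 0" "p \<circ>\<^sub>p [:0, -1:] = smult s p" using assms by (auto simp: has_parity_def)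
  have "poly p (- x) = s * poly p x" for x
    using arg_cong[OF s(2), of "\<lambda>p. poly p x"] by (simp add: poly_pcompose)
  then have "poly p (-x) = 0 \<longleftrightarrow> poly p x = 0" for x using s by simp
  then show ?thesis by (auto simp: image_iff) (metis minus_minus)
qed

text \<open>Leibniz's rule, in which only two terms survive because the second derivative of
  \<open>x\<close> is zero.\<close>

lemma higher_pderiv_x_mult:
  "(pderiv ^^ Suc j) ([:0, 1:] * f) = [:0, 1:] * (pderiv ^^ Suc j) f + smult (of_nat (Suc j)) ((pderiv ^^ j) (f :: real poly))"
proof (induction j)
  case 0
  then show ?case by (simp add: pderiv_mult pderiv_pCons)
next
  case (Suc j)
  have "(pderiv ^^ Suc (Suc j)) ([:0, 1:] * f) = pderiv ((pderiv ^^ Suc j) ([:0, 1:] * f))" by simp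
  also have "\<dots> = [:0, 1:] * (pderiv ^^ Suc (Suc j)) f + smult (of_nat (Suc (Suc j))) ((pderiv ^^ Suc j) f)"
    unfolding Suc.IH by (simp add: pderiv_mult pderiv_add pderiv_smult pderiv_pCons smult_add_left numeral_mult_conv_smult)
  finally show ?case .
qed

lemma higher_pderiv_diff: "(pderiv ^^ j) (p - q) = (pderiv ^^ j) p - (pderiv ^^ j) (q :: real poly)"
  by (induction j) (auto simp: pderiv_diff)

text \<open>This is Legendre's equation \<open>(x\<^sup>2 - 1) P'' + 2 x P' = n (n + 1) P\<close> at \<open>x = -1\<close>. It comes from
  differentiating \<open>(x\<^sup>2 - 1) u' = 2 n x u\<close>, where \<open>u = (x\<^sup>2 - 1)\<^sup>n\<close>, \<open>n + 1\<close> times.\<close>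

lemma legendre_endpoint:
  assumes "n > 0"
  shows "2 * poly (pderiv (legendre n)) (-1) = - (real n * (real n + 1)) * poly (legendre n) (-1)"
proof -
  define u where "u = ([:-1, 0, 1:] :: real poly) ^ n"
  define D where "D = (\<lambda>j p. poly ((pderiv ^^ j) p) (-1 :: real))"
  obtain m where m: "n = Suc m" using assms by (cases n) auto
  have "pderiv u = smult (2 * real n) ([:0, 1:] * [:-1, 0, 1:] ^ m)"
    unfolding u_def m pderiv_power_Suc by (simp add: pderiv_pCons mult.commute)
  then have "[:-1, 0, 1:] * pderiv u = smult (2 * real n) ([:0, 1:] * u)"
    by (simp only: u_def m power_Suc mult_smult_right mult.left_commute)
  \<comment> \<open>Written this way, the equation involves only products with \<open>x\<close>,
    which \<open>higher_pderiv_x_mult\<close> can differentiate.\<close>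
  moreover have "[:-1, 0, 1:] = [:0, 1:] * [:0, 1:] - (1 :: real poly)"
    by (simp add: one_pCons)
  ultimately have eq: "[:0, 1:] * ([:0, 1:] * pderiv u) - pderiv u = smult (2 * real n) ([:0, 1:] * u)"
    by (simp only: left_diff_distrib mult.assoc mult_1)
  have x: "D (Suc j) ([:0, 1:] * f) = real (Suc j) * D j f - D (Suc j) f" for j f
    unfolding D_def higher_pderiv_x_mult by simp
  have D': "D j (pderiv f) = D (Suc j) f" for j f
    by (simp only: D_def funpow_Suc_right comp_def)
  have "D (Suc n) ([:0, 1:] * ([:0, 1:] * pderiv u) - pderiv u) = 2 * real n * D (Suc n) ([:0, 1:] * u)"
    unfolding eq by (simp only: D_def higher_pderiv_smult poly_smult)
  then have "D (Suc n) ([:0, 1:] * ([:0, 1:] * pderiv u)) - D (Suc n) (pderiv u) = 2 * real n * D (Suc n) ([:0, 1:] * u)"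
    by (simp only: D_def higher_pderiv_diff poly_diff)
  moreover have e: "D n ([:0, 1:] * pderiv u) = real n * D n u - D (Suc n) u"
    unfolding m x D' ..
  \<comment> \<open>The two terms with the derivative of \<open>u\<close> of order
    \<open>n + 2\<close> cancel.\<close>
  ultimately have "2 * D (Suc n) u = - (real n * (real n + 1)) * D n u"
    unfolding x D' e by (simp add: algebra_simps)
  then show ?thesis
    by (simp add: legendre_def pderiv_smult D_def u_def)
qed

subsection \<open>Gauss and Gauss--Lobatto rules\<close>

lemma G_nodes:
  shows "bij_betw (G_node n) {1..n} {x. poly (legendre n) x = 0}"
    and "i \<in> {1..n} \<Longrightarrow> poly (legendre n) (G_node n i) = 0"
    and "i \<in> {1..n} \<Longrightarrow> G_node n i \<in> {-1<..<1}"
    and "i \<in> {1..n} \<Longrightarrow> G_node n (n + 1 - i) = - G_node n i"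
proof -
  note fin = poly_roots_finite[OF legendre_neq_0[of n]]
  show bij: "bij_betw (G_node n) {1..n} {x. poly (legendre n) x = 0}"
    using bij_betw_sorted_nodes[OF fin] unfolding legendre_roots(2) by (simp add: G_node_def[abs_def])
  show "poly (legendre n) (G_node n i) = 0" if "i \<in> {1..n}"
    using bij_betwE[OF bij] that by blast
  then show "G_node n i \<in> {-1<..<1}" if "i \<in> {1..n}"
    using that legendre_roots(1) by blast
  show "G_node n (n + 1 - i) = - G_node n i" if "i \<in> {1..n}"
    using sorted_nodes_reflect[OF fin has_parity_roots[OF has_parity_legendre], of i] that
    unfolding legendre_roots(2) G_node_def by simp
qed

lemma G_exact:
  assumes "n > 0" "degree p < 2 * n"
  shows "mean p = (\<Sum>i=1..n. G_weight n i * poly p (G_node n i))"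
  unfolding G_weight_def
  using assms G_nodes legendre_orthogonal
  by (intro quadrature_exact[where W = "legendre n" and m = n]) (auto simp: bij_betw_def degree_legendre)

text \<open>Isolates one weight by a test polynomial that vanishes at all other nodes.\<close>

lemma mean_single_node:
  fixes n :: nat
  assumes "mean p = (\<Sum>j=1..n. w j * poly p (\<xi> j))" "i \<in> {1..n}"
    and "\<And>j. j \<in> {1..n} \<Longrightarrow> j \<noteq> i \<Longrightarrow> poly p (\<xi> j) = 0"
  shows "mean p = w i * poly p (\<xi> i)"
proof -
  have "(\<Sum>j\<in>{1..n} - {i}. w j * poly p (\<xi> j)) = 0"
    using assms(3) by (intro sum.neutral) auto
  then show ?thesis
    unfolding assms(1) sum.remove[OF finite_atLeastAtMost assms(2)] by simp
qed

lemma weight_pos: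
  assumes "mean p = w * poly p x" "\<And>y. y \<in> {-1..1} \<Longrightarrow> poly p y \<ge> 0" "p \<noteq> 0" "x \<in> {-1..1}"
  shows "w > 0"
  using mean_pos[OF assms(2,3)] assms(1) assms(2)[OF assms(4)] by (auto simp: zero_less_mult_iff)

text \<open>The square of the basis polynomial has degree at most \<open>2 * n - 2\<close>, within
  the exactness of the rule, and sees only the node \<open>i\<close>.\<close>

lemma G_weight_pos:
  assumes i: "i \<in> {1..n}"
  shows "G_weight n i > 0"
proof -
  let ?l = "lagrange n (G_node n) i"
  have inj: "inj_on (G_node n) {1..n}" using G_nodes(1) by (simp add: bij_betw_def)
  note val = poly_lagrange_node[OF inj i]
  have "degree (?l * ?l) \<le> (n - 1) + (n - 1)"
    by (intro order.trans[OF degree_mult_le] add_mono degree_lagrange i)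
  then have "mean (?l * ?l) = G_weight n i * poly (?l * ?l) (G_node n i)"
    using i val by (intro mean_single_node[OF G_exact]) auto
  moreover have "?l \<noteq> 0" using val[OF i] by auto
  ultimately show ?thesis
    using G_nodes(3)[OF i] by (intro weight_pos[of "?l * ?l"]) auto
qed

lemma G_weight_reflect: "i \<in> {1..n} \<Longrightarrow> G_weight n (n + 1 - i) = G_weight n i"
  unfolding G_weight_def using G_nodes(1,4) by (intro quad_weight_reflect) (auto simp: bij_betw_def)

section \<open>The Gauss--Lobatto rule and its nodal polynomial\<close>

definition lobatto :: "nat \<Rightarrow> real poly" where
  "lobatto n = [:1, 0, -1:] * pderiv (legendre (n - 1))"

lemma poly_lobatto: "poly (lobatto n) x = (1 - x\<^sup>2) * poly (pderiv (legendre (n - 1))) x"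
  by (simp add: lobatto_def power2_eq_square algebra_simps)

lemma lobatto_neq_0: "n \<ge> 2 \<Longrightarrow> lobatto n \<noteq> 0"
  using pderiv_legendre_neq_0[of "n - 1"] by (simp add: lobatto_def del: mult_pCons_left)

lemma degree_lobatto: "n \<ge> 2 \<Longrightarrow> degree (lobatto n) = n"
  using pderiv_legendre_neq_0[of "n - 1"]
  by (simp add: lobatto_def degree_mult_eq degree_pderiv degree_legendre del: mult_pCons_left)

lemma lobatto_roots:
  assumes "n \<ge> 2"
  shows "{x. poly (lobatto n) x = 0} \<subseteq> {-1..1}" and "card {x. poly (lobatto n) x = 0} = n"
    and "{-1, 1} \<subseteq> {x. poly (lobatto n) x = 0}"
proof -
  let ?R = "{x. poly (pderiv (legendre (n - 1))) x = 0}"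
  have R: "?R \<subseteq> {-1<..<1}" "card ?R = n - 2" "finite ?R"
    using pderiv_legendre_roots[of "n - 1"] poly_roots_finite[OF pderiv_legendre_neq_0[of "n - 1"]] assms by auto
  have eq: "{x. poly (lobatto n) x = 0} = insert (-1) (insert 1 ?R)"
    by (auto simp: poly_lobatto power2_eq_1_iff)
  have "-1 \<notin> ?R" "1 \<notin> ?R" using R(1) by auto
  then show "card {x. poly (lobatto n) x = 0} = n"
    unfolding eq using R assms by simp
  show "{x. poly (lobatto n) x = 0} \<subseteq> {-1..1}" "{-1, 1} \<subseteq> {x. poly (lobatto n) x = 0}"
    unfolding eq using R(1) by auto
qed

lemma has_parity_lobatto: "has_parity (lobatto n)"
  unfolding lobatto_def
  by (intro has_parity_mult has_parity_pderiv has_parity_legendre)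
     (auto simp: has_parity_def pcompose_pCons intro!: exI[of _ 1])

text \<open>Integration by parts has no boundary terms because of the factor \<open>1 - x^2\<close>,
  and leaves \<open>legendre (n - 1)\<close> against a polynomial of degree below
  \<open>n - 1\<close>.\<close>

lemma lobatto_orthogonal:
  assumes "degree g < n - 2"
  shows "mean (lobatto n * g) = 0"
proof -
  let ?g = "[:1, 0, -1:] * g"
  have "degree ?g \<le> 2 + degree g"
    by (rule order.trans[OF degree_mult_le]) simp
  then have "degree (pderiv ?g) < n - 1"
    unfolding degree_pderiv using assms by linarith
  then have "mean (legendre (n - 1) * pderiv ?g) = 0"
    by (rule legendre_orthogonal)
  then have "mean (pderiv (legendre (n - 1)) * ?g) = 0"
    unfolding mean_by_parts by simp
  then show ?thesis
    by (simp only: lobatto_def ac_simps)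
qed

lemma GL_nodes:
  assumes n: "n \<ge> 2"
  shows "bij_betw (GL_node n) {1..n} {x. poly (lobatto n) x = 0}"
    and "i \<in> {1..n} \<Longrightarrow> poly (lobatto n) (GL_node n i) = 0"
    and "i \<in> {1..n} \<Longrightarrow> GL_node n i \<in> {-1..1}"
    and "i \<in> {1..n} \<Longrightarrow> GL_node n (n + 1 - i) = - GL_node n i"
    and "GL_node n 1 = -1" and "GL_node n n = 1"
    and "i \<in> {2..n - 1} \<Longrightarrow> poly (pderiv (legendre (n - 1))) (GL_node n i) = 0"
proof -
  note fin = poly_roots_finite[OF lobatto_neq_0[OF n]]
  have GL: "GL_node n i = sorted_list_of_set {x. poly (lobatto n) x = 0} ! (i - 1)" for i
    by (simp only: GL_node_def lobatto_def)
  show bij: "bij_betw (GL_node n) {1..n} {x. poly (lobatto n) x = 0}"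
    using bij_betw_sorted_nodes[OF fin] unfolding lobatto_roots(2)[OF n] by (simp add: GL[abs_def])
  show root: "poly (lobatto n) (GL_node n i) = 0" if "i \<in> {1..n}" for i
    using bij_betwE[OF bij] that by blast
  then show "GL_node n i \<in> {-1..1}" if "i \<in> {1..n}"
    using that lobatto_roots(1)[OF n] by blast
  show refl: "GL_node n (n + 1 - i) = - GL_node n i" if "i \<in> {1..n}" for i
    using sorted_nodes_reflect[OF fin has_parity_roots[OF has_parity_lobatto], of i] that
    unfolding lobatto_roots(2)[OF n] GL by simp
  let ?xs = "sorted_list_of_set {x. poly (lobatto n) x = 0}"
  have "-1 \<in> set ?xs" using lobatto_roots(3)[OF n] fin by simp
  then obtain j where "j < length ?xs" "?xs ! j = -1" by (auto simp: in_set_conv_nth)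
  \<comment> \<open>The first entry of the sorted list is at most its entry \<open>-1\<close>, while
    all zeros lie in \<open>[-1, 1]\<close>. The last node follows by reflection.\<close>
  then have "?xs ! 0 \<le> -1"
    using sorted_nth_mono[of ?xs 0 j] by simp
  moreover have "?xs ! 0 \<in> {-1..1}"
    using root[of 1] lobatto_roots(1)[OF n] n unfolding GL by auto
  ultimately show first: "GL_node n 1 = -1" by (simp add: GL)
  then show last: "GL_node n n = 1"
    using refl[of 1] n by simp
  show "poly (pderiv (legendre (n - 1))) (GL_node n i) = 0" if "i \<in> {2..n - 1}"
  proof -
    have inj: "inj_on (GL_node n) {1..n}" using bij by (simp add: bij_betw_def)
    have "GL_node n i \<noteq> GL_node n 1" "GL_node n i \<noteq> GL_node n n"
      using that n by (auto dest!: inj_onD[OF inj])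
    then have "(GL_node n i)\<^sup>2 \<noteq> 1"
      using first last by (simp add: power2_eq_1_iff)
    then show ?thesis
      using root[of i] that by (auto simp: poly_lobatto)
  qed
qed

text \<open>Orthogonality reaches only degrees below \<open>n - 2\<close>, which gives the bound
  \<open>n + (n - 2)\<close>.\<close>

lemma GL_exact:
  assumes "n \<ge> 2" "degree p < 2 * n - 2"
  shows "mean p = (\<Sum>i=1..n. GL_weight n i * poly p (GL_node n i))"
  unfolding GL_weight_def
  using assms GL_nodes[OF assms(1)] lobatto_orthogonal[of _ n]
  by (intro quadrature_exact[where W = "lobatto n" and m = "n - 2"]) (auto simp: bij_betw_def degree_lobatto)

text \<open>With \<open>?P = (x - ?x) * h\<close>, the test polynomial
  \<open>(1 - x^2) * h^2\<close> is nonnegative on \<open>[-1, 1]\<close> and vanishes at both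
  endpoints and at every interior node other than \<open>?x\<close>.\<close>

lemma GL_weight_pos:
  assumes n: "n \<ge> 2" and i: "i \<in> {2..n - 1}"
  shows "GL_weight n i > 0"
proof -
  let ?x = "GL_node n i"
  let ?P = "pderiv (legendre (n - 1))"
  obtain h where h: "?P = [:- ?x, 1:] * h"
    using GL_nodes(7)[OF n i] unfolding poly_eq_0_iff_dvd by (rule dvdE)
  have "?P \<noteq> 0" using n by (intro pderiv_legendre_neq_0) simp
  then have "h \<noteq> 0" using h by auto
  have "degree ?P = 1 + degree h"
    unfolding h using \<open>h \<noteq> 0\<close> by (subst degree_mult_eq) auto
  then have deg: "degree h = n - 3" "n \<ge> 3"
    using n i by (auto simp: degree_pderiv degree_legendre)
  \<comment> \<open>The degree of \<open>p\<close> is \<open>2 n - 4\<close>; the square of the Lagrange polynomial would have too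
    large a degree for the rule to be exact.\<close>
  define p where "p = [:1, 0, -1:] * (h * h)"
  have "p \<noteq> 0" using \<open>h \<noteq> 0\<close> by (simp add: p_def del: mult_pCons_left)
  have p: "poly p y = (1 - y\<^sup>2) * (poly h y)\<^sup>2" for y
    by (simp add: p_def power2_eq_square algebra_simps)
  have "degree p = 2 + (degree h + degree h)"
    unfolding p_def using \<open>h \<noteq> 0\<close> by (simp add: degree_mult_eq del: mult_pCons_left)
  then have "mean p = (\<Sum>j=1..n. GL_weight n j * poly p (GL_node n j))"
    using deg by (intro GL_exact n) simp
  then have "mean p = GL_weight n i * poly p ?x"
  proof (rule mean_single_node)
    fix j assume j: "j \<in> {1..n}" "j \<noteq> i"
    have "poly (lobatto n) (GL_node n j) = 0" by (rule GL_nodes(2)[OF n j(1)])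
    moreover have "GL_node n j \<noteq> ?x"
      using j i n GL_nodes(1)[OF n] by (auto simp: bij_betw_def dest: inj_onD)
    moreover have "poly ?P (GL_node n j) = (GL_node n j - ?x) * poly h (GL_node n j)"
      by (subst h) (simp add: algebra_simps)
    ultimately show "poly p (GL_node n j) = 0"
      by (auto simp: poly_lobatto p)
  qed (use i in auto)
  then show ?thesis
    using \<open>p \<noteq> 0\<close> GL_nodes(3)[OF n, of i] i
    by (intro weight_pos[of p]) (auto simp: p abs_square_le_1)
qed

lemma GL_weight_reflect: "n \<ge> 2 \<Longrightarrow> i \<in> {1..n} \<Longrightarrow> GL_weight n (n + 1 - i) = GL_weight n i"
  unfolding GL_weight_def using GL_nodes(1,4)[of n]
  by (intro quad_weight_reflect) (auto simp: bij_betw_def)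

text \<open>Integration by parts reduces the mean of the test polynomial to
  \<open>- poly ?P (-1)\<close>, as \<open>?P\<close> is orthogonal to constants.
  \<open>legendre_endpoint\<close> at index \<open>n - 1\<close> then relates \<open>?P\<close> to
  its derivative at \<open>-1\<close>.\<close>

lemma GL_weight_1:
  assumes n: "n \<ge> 2"
  shows "GL_weight n 1 = 1 / (real n * (real n - 1))"
proof -
  let ?P = "legendre (n - 1)"
  \<comment> \<open>\<open>(1 - x) P'(x)\<close> vanishes at all nodes but the first.\<close>
  have "mean (pderiv ?P * [:1, -1:]) = - poly ?P (-1)"
  proof -
    have "mean (?P * [:-1:]) = 0"
      using n by (intro legendre_orthogonal) simp
    then show ?thesis
      unfolding mean_by_parts by (simp add: pderiv_pCons)
  qed
  moreover have "mean (pderiv ?P * [:1, -1:]) = GL_weight n 1 * poly (pderiv ?P * [:1, -1:]) (GL_node n 1)"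
  proof (rule mean_single_node[OF GL_exact[OF n]])
    have "degree (pderiv ?P * [:1, -1:]) \<le> (n - 2) + 1"
      by (rule order.trans[OF degree_mult_le]) (simp add: degree_pderiv degree_legendre)
    then show "degree (pderiv ?P * [:1, -1:]) < 2 * n - 2" using n by simp
    fix j assume j: "j \<in> {1..n}" "j \<noteq> 1"
    then have "j = n \<or> j \<in> {2..n - 1}" by auto
    then show "poly (pderiv ?P * [:1, -1:]) (GL_node n j) = 0"
      using GL_nodes(6,7)[OF n] by auto
  qed (use n in auto)
  ultimately have w: "GL_weight n 1 * (2 * poly (pderiv ?P) (-1)) = - poly ?P (-1)"
    using GL_nodes(5)[OF n] by (simp add: algebra_simps)
  have "real (n - 1) = real n - 1" using n by simp
  with legendre_endpoint[of "n - 1"] n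
  have e: "2 * poly (pderiv ?P) (-1) = - (real n * (real n - 1)) * poly ?P (-1)"
    by (simp add: mult.commute)
  have "poly ?P (-1) \<noteq> 0" using legendre_roots(1)[of "n - 1"] by auto
  then have "GL_weight n 1 * (real n * (real n - 1)) = 1"
    using w unfolding e by (simp del: One_nat_def)
  then show ?thesis using n by (simp add: eq_divide_eq)
qed

subsection \<open>Polynomials in two variables\<close>

lemma Qspace_scaled: "p \<in> Qspace k \<Longrightarrow> (\<lambda>z. a * p z) \<in> Qspace k"
proof -
  assume "p \<in> Qspace k"
  then obtain c where "\<forall>x y. p (x, y) = (\<Sum>i\<le>k. \<Sum>j\<le>k. c i j * x ^ i * y ^ j)"
    by (auto simp: Qspace_def)
  then show ?thesis
    unfolding Qspace_def
    by (auto simp: sum_distrib_left mult.assoc intro!: exI[of _ "\<lambda>i j. a * c i j"])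
qed

lemma Qspace_add:
  assumes "p \<in> Qspace k" "q \<in> Qspace k"
  shows "(\<lambda>z. p z + q z) \<in> Qspace k"
proof -
  obtain c d where "\<forall>x y. p (x, y) = (\<Sum>i\<le>k. \<Sum>j\<le>k. c i j * x ^ i * y ^ j)"
      "\<forall>x y. q (x, y) = (\<Sum>i\<le>k. \<Sum>j\<le>k. d i j * x ^ i * y ^ j)"
    using assms by (auto simp: Qspace_def)
  then show ?thesis
    unfolding Qspace_def
    by (auto simp: sum.distrib algebra_simps intro!: exI[of _ "\<lambda>i j. c i j + d i j"])
qed

lemma Qspace_sum:
  assumes "\<And>i. i \<in> A \<Longrightarrow> f i \<in> Qspace k"
  shows "(\<lambda>z. \<Sum>i\<in>A. f i z) \<in> Qspace k"
proof -
  have "(\<lambda>z. 0) \<in> Qspace k"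
    by (auto simp: Qspace_def intro!: exI[of _ "\<lambda>_ _. 0"])
  then show ?thesis
    using assms by (induction A rule: infinite_finite_induct) (auto intro: Qspace_add)
qed

lemma Qspace_product:
  assumes "degree f \<le> k" "degree g \<le> k"
  shows "(\<lambda>z. poly f (fst z) * poly g (snd z)) \<in> Qspace k"
proof -
  have "poly f x * poly g y = (\<Sum>i\<le>k. \<Sum>j\<le>k. coeff f i * coeff g j * x ^ i * y ^ j)" for x y
  proof -
    have "poly h t = (\<Sum>i\<le>k. coeff h i * t ^ i)" if "degree h \<le> k" for h :: "real poly" and t
      using arg_cong[OF poly_as_sum_of_monoms'[OF that], of "\<lambda>h. poly h t"]
      by (simp add: poly_sum poly_monom)
    then show ?thesis
      using assms by (simp add: sum_product mult_ac)
  qed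
  then show ?thesis
    unfolding Qspace_def by (auto intro!: exI[of _ "\<lambda>i j. coeff f i * coeff g j"])
qed

text \<open>The square is expanded into scaled products of monomials of degree at most
  \<open>2 * m\<close> in each variable, so the closure lemmas apply and no coefficients have to be
  collected.\<close>

lemma Qspace_square:
  assumes "q \<in> Qspace m" "2 * m \<le> k"
  shows "(\<lambda>z. (q z)\<^sup>2) \<in> Qspace k"
proof -
  obtain c where c: "\<forall>x y. q (x, y) = (\<Sum>i\<le>m. \<Sum>j\<le>m. c i j * x ^ i * y ^ j)"
    using assms(1) by (auto simp: Qspace_def)
  have "(\<lambda>z. (q z)\<^sup>2) = (\<lambda>z. \<Sum>i\<le>m. \<Sum>i'\<le>m. \<Sum>j\<le>m. \<Sum>j'\<le>m.
     (c i j * c i' j') * (poly (monom 1 (i + i')) (fst z) * poly (monom 1 (j + j')) (snd z)))"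
  proof
    fix z :: "real \<times> real"
    have "q z = (\<Sum>i\<le>m. \<Sum>j\<le>m. c i j * fst z ^ i * snd z ^ j)"
      using c by (metis prod.collapse)
    then show "(q z)\<^sup>2 = (\<Sum>i\<le>m. \<Sum>i'\<le>m. \<Sum>j\<le>m. \<Sum>j'\<le>m.
     (c i j * c i' j') * (poly (monom 1 (i + i')) (fst z) * poly (monom 1 (j + j')) (snd z)))"
      by (simp add: power2_eq_square sum_product poly_monom power_add mult_ac)
  qed
  moreover have "degree (monom (1 :: real) (i + i')) \<le> k" if "i \<le> m" "i' \<le> m" for i i'
    using assms(2) that by (simp add: degree_monom_eq)
  ultimately show ?thesis
    by (auto intro!: Qspace_sum Qspace_scaled Qspace_product)
qed

lemma Qspace_swap:
  assumes "p \<in> Qspace k"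
  shows "p \<circ> prod.swap \<in> Qspace k"
proof -
  obtain c where c: "\<forall>x y. p (x, y) = (\<Sum>i\<le>k. \<Sum>j\<le>k. c i j * x ^ i * y ^ j)"
    using assms by (auto simp: Qspace_def)
  have "p (y, x) = (\<Sum>i\<le>k. \<Sum>j\<le>k. c j i * x ^ i * y ^ j)" for x y
    using c by (subst sum.swap) (simp add: mult_ac)
  then show ?thesis
    unfolding Qspace_def by (auto intro!: exI[of _ "\<lambda>i j. c j i"])
qed

text \<open>Makes the one-dimensional rules applicable on horizontal lines;
  \<open>Qspace_swap\<close> gives the same on vertical ones.\<close>

lemma Qspace_section:
  assumes "p \<in> Qspace k"
  obtains f where "degree f \<le> k" "\<And>x. p (x, y) = poly f x"
proof -
  obtain c where c: "\<forall>x y. p (x, y) = (\<Sum>i\<le>k. \<Sum>j\<le>k. c i j * x ^ i * y ^ j)"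
    using assms by (auto simp: Qspace_def)
  show ?thesis
  proof
    show "degree (\<Sum>i\<le>k. monom (\<Sum>j\<le>k. c i j * y ^ j) i) \<le> k"
      by (intro degree_sum_le) (auto intro: order.trans[OF degree_monom_le])
    show "p (x, y) = poly (\<Sum>i\<le>k. monom (\<Sum>j\<le>k. c i j * y ^ j) i) x" for x
      using c by (simp add: poly_sum poly_monom sum_distrib_right sum_distrib_left mult_ac)
  qed
qed

lemma continuous_on_Qspace:
  assumes "p \<in> Qspace k"
  shows "continuous_on A p"
proof -
  obtain c where c: "\<forall>x y. p (x, y) = (\<Sum>i\<le>k. \<Sum>j\<le>k. c i j * x ^ i * y ^ j)"
    using assms by (auto simp: Qspace_def)
  have "p = (\<lambda>z. \<Sum>i\<le>k. \<Sum>j\<le>k. c i j * fst z ^ i * snd z ^ j)"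
    using c by (auto simp: fun_eq_iff)
  then show ?thesis
    by (simp only:) (intro continuous_intros)
qed

lemma integrable_section:
  assumes "p \<in> Qspace k"
  shows "(\<lambda>x. p (x, y)) integrable_on {a..b}" "(\<lambda>y. p (x, y)) integrable_on {a..b}"
  by (intro integrable_continuous_real
       continuous_on_compose2[OF continuous_on_Qspace[OF assms, of UNIV]] continuous_intros; simp)+

lemma avg_iterated:
  assumes "p \<in> Qspace k"
  shows "avg p = 1/4 * integral {-1..1} (\<lambda>y. integral {-1..1} (\<lambda>x. p (x, y)))"
proof -
  have O: "Omega = cbox (-1, -1) (1, 1)"
    by (auto simp: Omega_def cbox_Pair_iff)
  have c: "continuous_on A p" for A using continuous_on_Qspace[OF assms] .
  \<comment> \<open>Fubini's theorem is applied with the first coordinate outermost, so the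
    coordinates are exchanged first to make \<open>x\<close> the inner variable.\<close>
  have "integral Omega p = integral (cbox (-1, -1) (1, 1)) (\<lambda>(x, y). p (y, x))"
    unfolding O using integral_swap_2dim[of "-1" "-1" 1 1 "\<lambda>x y. p (x, y)"] c by simp
  also have "\<dots> = integral (cbox (-1) 1) (\<lambda>y. integral (cbox (-1) 1) (\<lambda>x. p (x, y)))"
    using continuous_on_Qspace[OF Qspace_swap[OF assms]]
    by (subst integral_prod_continuous) (auto simp: comp_def case_prod_beta prod.swap_def)
  finally show ?thesis by (simp add: avg_def)
qed

lemma avg_swap:
  assumes "p \<in> Qspace k"
  shows "avg (p \<circ> prod.swap) = avg p"
proof -
  have O: "Omega = cbox (-1, -1) (1, 1)"
    by (auto simp: Omega_def cbox_Pair_iff)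
  show ?thesis
    unfolding avg_def O
    using integral_swap_2dim[of "-1" "-1" 1 1 "\<lambda>x y. p (x, y)"] continuous_on_Qspace[OF assms]
    by (simp add: comp_def case_prod_unfold prod.swap_def)
qed

lemma avg_x_swap: "avg_x (p \<circ> prod.swap) = avg_y p"
  by (simp add: avg_x_def avg_y_def)

subsection \<open>The classic decomposition and its optimality\<close>

text \<open>The case \<open>\<theta> = 1\<close> of \<open>classic_interior\<close>: Gauss--Lobatto
  in the first coordinate, endpoints left out, and Gauss in the second.\<close>

definition tensor :: "nat \<Rightarrow> nat \<Rightarrow> (real \<times> real \<Rightarrow> real) \<Rightarrow> real" where
  "tensor L Q f = (\<Sum>l=2..L-1. GL_weight L l * (\<Sum>q=1..Q. G_weight Q q * f (GL_node L l, G_node Q q)))"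

lemma classic_interior_eq_tensor:
  "classic_interior \<theta> L Q f = (1 + \<theta>) / 2 * tensor L Q f + (1 - \<theta>) / 2 * tensor L Q (f \<circ> prod.swap)"
  by (simp add: classic_interior_def tensor_def sum_distrib_left mult.assoc)

lemma sum_split_ends:
  fixes f :: "nat \<Rightarrow> real"
  assumes "L \<ge> 2"
  shows "(\<Sum>l=1..L. f l) = f 1 + f L + (\<Sum>l=2..L-1. f l)"
proof -
  have "{1..L} = insert 1 (insert L {2..L-1})" using assms by auto
  then show ?thesis using assms by (simp add: add.assoc)
qed

text \<open>Gauss--Lobatto in \<open>x\<close> is integrated over \<open>y\<close>. The two endpoint
  terms stay integrals and combine into \<open>avg_x\<close>, their weights being equal; Gauss is
  applied only on the interior lines. The factor 2 turns the \<open>1/4\<close> of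
  \<open>avg_x\<close> into a mean over each edge.\<close>

lemma tensor_decomposition:
  assumes p: "p \<in> Qspace k" and "L \<ge> 2" "k < 2 * L - 2" "k < 2 * Q"
  shows "avg p = 2 * GL_weight L 1 * avg_x p + tensor L Q p"
proof -
  have GL: "1/2 * integral {-1..1} (\<lambda>x. p (x, y)) = (\<Sum>l=1..L. GL_weight L l * p (GL_node L l, y))" for y
  proof -
    obtain f where f: "degree f \<le> k" "\<And>x. p (x, y) = poly f x"
      using Qspace_section[OF p] by blast
    show ?thesis
      using GL_exact[of L f] f assms by (simp add: mean_def)
  qed
  have G: "1/2 * integral {-1..1} (\<lambda>y. p (x, y)) = (\<Sum>q=1..Q. G_weight Q q * p (x, G_node Q q))" for x
  proof -
    obtain f where f: "degree f \<le> k" "\<And>y. (p \<circ> prod.swap) (y, x) = poly f y"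
      using Qspace_section[OF Qspace_swap[OF p]] by blast
    show ?thesis
      using G_exact[of Q f] f assms by (simp add: mean_def)
  qed
  note int = integrable_section[OF p]
  have "avg p = 1/2 * integral {-1..1} (\<lambda>y. 1/2 * integral {-1..1} (\<lambda>x. p (x, y)))"
    by (simp add: avg_iterated[OF p])
  also have "\<dots> = 1/2 * integral {-1..1} (\<lambda>y. \<Sum>l=1..L. GL_weight L l * p (GL_node L l, y))"
    by (simp only: GL)
  also have "\<dots> = (\<Sum>l=1..L. GL_weight L l * (1/2 * integral {-1..1} (\<lambda>y. p (GL_node L l, y))))"
    by (subst integral_sum) (auto intro!: integrable_on_mult_right int simp: sum_distrib_left mult_ac)
  also have "\<dots> = GL_weight L 1 * (1/2 * integral {-1..1} (\<lambda>y. p (-1, y)))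
     + GL_weight L 1 * (1/2 * integral {-1..1} (\<lambda>y. p (1, y))) + tensor L Q p"
    using assms(2) GL_weight_reflect[of L 1] GL_nodes(5,6)[of L]
    by (simp only: sum_split_ends tensor_def G) simp
  also have "GL_weight L 1 * (1/2 * integral {-1..1} (\<lambda>y. p (-1, y)))
     + GL_weight L 1 * (1/2 * integral {-1..1} (\<lambda>y. p (1, y))) = 2 * GL_weight L 1 * avg_x p"
    by (simp add: avg_x_def integral_add[OF int(2) int(2)] algebra_simps)
  finally show ?thesis .
qed

lemma classic_decomposition:
  assumes p: "p \<in> Qspace k" and "L \<ge> 2" "k < 2 * L - 2" "k < 2 * Q"
  shows "avg p = GL_weight L 1 * bdry_avg \<theta> p + classic_interior \<theta> L Q p"
proof -
  have x: "avg p = 2 * GL_weight L 1 * avg_x p + tensor L Q p"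
    by (rule tensor_decomposition[OF assms])
  have y: "avg p = 2 * GL_weight L 1 * avg_y p + tensor L Q (p \<circ> prod.swap)"
    using tensor_decomposition[OF Qspace_swap[OF p] assms(2-4)] by (simp only: avg_swap[OF p] avg_x_swap)
  have "avg p = (1 + \<theta>) / 2 * avg p + (1 - \<theta>) / 2 * avg p"
    by (simp add: field_simps)
  also have "\<dots> = (1 + \<theta>) / 2 * (2 * GL_weight L 1 * avg_x p + tensor L Q p)
     + (1 - \<theta>) / 2 * (2 * GL_weight L 1 * avg_y p + tensor L Q (p \<circ> prod.swap))"
    by (simp only: x[symmetric] y[symmetric])
  also have "\<dots> = GL_weight L 1 * bdry_avg \<theta> p + classic_interior \<theta> L Q p"
    by (simp add: bdry_avg_def classic_interior_eq_tensor field_simps)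
  finally show ?thesis .
qed

text \<open>Reflection reverses the numbering of the nodes and keeps the weights; the interior range
  \<open>{2..L-1}\<close> is mapped to itself.\<close>

lemma tensor_reflect:
  assumes "L \<ge> 2"
  shows "tensor L Q (\<lambda>(x, y). f (-x, y)) = tensor L Q f"
    and "tensor L Q (\<lambda>(x, y). f (x, -y)) = tensor L Q f"
proof -
  have GL: "(\<Sum>l=2..L-1. GL_weight L l * h (- GL_node L l)) = (\<Sum>l=2..L-1. GL_weight L l * h (GL_node L l))" for h
  proof -
    have "(\<Sum>l=2..L-1. GL_weight L l * h (GL_node L l))
        = (\<Sum>l=2..L-1. GL_weight L (L - 1 + 2 - l) * h (GL_node L (L - 1 + 2 - l)))"
      by (rule sum.atLeastAtMost_rev)
    also have "\<dots> = (\<Sum>l=2..L-1. GL_weight L l * h (- GL_node L l))"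
    proof (intro sum.cong refl)
      fix l assume "l \<in> {2..L-1}"
      then have "L - 1 + 2 - l = L + 1 - l" "l \<in> {1..L}" by auto
      then show "GL_weight L (L - 1 + 2 - l) * h (GL_node L (L - 1 + 2 - l)) = GL_weight L l * h (- GL_node L l)"
        by (simp only: GL_weight_reflect[OF assms] GL_nodes(4)[OF assms])
    qed
    finally show ?thesis by simp
  qed
  have G: "(\<Sum>q=1..Q. G_weight Q q * h (- G_node Q q)) = (\<Sum>q=1..Q. G_weight Q q * h (G_node Q q))" for h
  proof -
    have "(\<Sum>q=1..Q. G_weight Q q * h (G_node Q q)) = (\<Sum>q=1..Q. G_weight Q (Q + 1 - q) * h (G_node Q (Q + 1 - q)))"
      by (rule sum.atLeastAtMost_rev)
    also have "\<dots> = (\<Sum>q=1..Q. G_weight Q q * h (- G_node Q q))"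
      by (intro sum.cong refl) (simp only: G_weight_reflect G_nodes(4))
    finally show ?thesis by simp
  qed
  show "tensor L Q (\<lambda>(x, y). f (-x, y)) = tensor L Q f"
    using GL[of "\<lambda>x. \<Sum>q=1..Q. G_weight Q q * f (x, G_node Q q)"] by (simp add: tensor_def)
  show "tensor L Q (\<lambda>(x, y). f (x, -y)) = tensor L Q f"
    using G[of "\<lambda>y. f (_, y)"] by (simp add: tensor_def)
qed

text \<open>Exchanging the coordinates exchanges the two reflections, so each half of the sum falls
  under one part of \<open>tensor_reflect\<close>.\<close>

lemma classic_interior_reflect:
  assumes "L \<ge> 2"
  shows "classic_interior \<theta> L Q (\<lambda>(x, y). f (-x, y)) = classic_interior \<theta> L Q f"
    and "classic_interior \<theta> L Q (\<lambda>(x, y). f (x, -y)) = classic_interior \<theta> L Q f"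
proof -
  have "(\<lambda>(x, y). f (-x, y)) \<circ> prod.swap = (\<lambda>(x, y). (f \<circ> prod.swap) (x, -y))"
    "(\<lambda>(x, y). f (x, -y)) \<circ> prod.swap = (\<lambda>(x, y). (f \<circ> prod.swap) (-x, y))"
    by auto
  then show "classic_interior \<theta> L Q (\<lambda>(x, y). f (-x, y)) = classic_interior \<theta> L Q f"
    "classic_interior \<theta> L Q (\<lambda>(x, y). f (x, -y)) = classic_interior \<theta> L Q f"
    by (simp_all only: classic_interior_eq_tensor tensor_reflect[OF assms])
qed

section \<open>Folding the interior nodes into the first quadrant\<close>

lemma classic_interior_eq_sum:
  fixes L Q :: nat and \<theta> :: real
  assumes "L \<ge> 2" "-1 \<le> \<theta>" "\<theta> \<le> 1"
  shows "\<exists>(A :: (nat \<times> nat + nat \<times> nat) set) w z. finite A \<and>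
    (\<forall>f. classic_interior \<theta> L Q f = (\<Sum>a\<in>A. w a * f (z a))) \<and>
    (\<forall>a\<in>A. w a \<ge> 0 \<and> z a \<in> Omega)"
proof -
  define I where "I = {2..L-1} \<times> {1..Q}"
  \<comment> \<open>A disjoint union of two copies of \<open>I\<close> indexes the two families, so
    a point occurring in both is simply listed twice.\<close>
  define w where "w = case_sum (\<lambda>(l, q). (1 + \<theta>) / 2 * (GL_weight L l * G_weight Q q))
    (\<lambda>(l, q). (1 - \<theta>) / 2 * (GL_weight L l * G_weight Q q))"
  define z where "z = case_sum (\<lambda>(l, q). (GL_node L l, G_node Q q)) (\<lambda>(l, q). (G_node Q q, GL_node L l))"
  have "finite I" by (simp add: I_def)
  have "classic_interior \<theta> L Q f = (\<Sum>a\<in>I <+> I. w a * f (z a))" for f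
    unfolding sum.Plus[OF \<open>finite I\<close> \<open>finite I\<close>]
    by (simp add: classic_interior_def I_def w_def z_def sum.cartesian_product sum_distrib_left
          case_prod_beta mult.assoc)
  moreover have "w a \<ge> 0 \<and> z a \<in> Omega" if a: "a \<in> I <+> I" for a
  proof -
    obtain l q where lq: "l \<in> {2..L-1}" "q \<in> {1..Q}" "a = Inl (l, q) \<or> a = Inr (l, q)"
      using a unfolding I_def by blast
    have "GL_weight L l > 0" "G_weight Q q > 0" "GL_node L l \<in> {-1..1}" "G_node Q q \<in> {-1<..<1}"
      using lq by (auto intro!: GL_weight_pos[OF assms(1)] G_weight_pos GL_nodes(3)[OF assms(1)] G_nodes(3)
        simp del: greaterThanLessThan_iff atLeastAtMost_iff) auto
    then show ?thesis
      using lq(3) assms(2,3) by (auto simp: w_def z_def Omega_def)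
  qed
  ultimately show ?thesis
    using \<open>finite I\<close> by (intro exI[of _ "I <+> I"] exI[of _ w] exI[of _ z]) simp
qed

lemma sym_avg_abs: "sym_avg f (\<bar>x\<bar>, \<bar>y\<bar>) = sym_avg f (x, y)"
  by (cases "x \<ge> 0"; cases "y \<ge> 0") (auto simp: sym_avg_def)

text \<open>The nodes need not be merged: by the reflection invariance every node may be folded into
  the first quadrant separately, keeping its weight, and nodes of weight zero (which occur for
  \<open>\<theta> = \<plusminus>1\<close>) are dropped.\<close>

lemma symmetric_grouping:
  assumes "finite A" and I: "\<And>f. I f = (\<Sum>a\<in>A. w a * f (z a))"
    and "\<And>a. a \<in> A \<Longrightarrow> w a \<ge> (0 :: real)" "\<And>a. a \<in> A \<Longrightarrow> z a \<in> Omega"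
    and rx: "\<And>f. I (\<lambda>(x, y). f (-x, y)) = I f" and ry: "\<And>f. I (\<lambda>(x, y). f (x, -y)) = I f"
  shows "\<exists>(S :: nat) \<omega> z'. (\<forall>f. I f = (\<Sum>s=1..S. \<omega> s * sym_avg f (z' s))) \<and>
    (\<forall>s\<in>{1..S}. \<omega> s > 0 \<and> z' s \<in> {0..1} \<times> {0..1})"
proof -
  define B where "B = {a \<in> A. w a \<noteq> 0}"
  define za where "za = (\<lambda>a. (\<bar>fst (z a)\<bar>, \<bar>snd (z a)\<bar>))"
  have "finite B" using assms(1) by (simp add: B_def)
  obtain h where h: "bij_betw h {1..card B} B"
    using ex_bij_betw_nat_finite_1[OF \<open>finite B\<close>] by blast
  have "I f = (\<Sum>s=1..card B. w (h s) * sym_avg f (za (h s)))" for f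
  proof -
    \<comment> \<open>All four terms equal \<open>I f\<close>. The double reflection is nested so
      that \<open>rx\<close> and then \<open>ry\<close> rewrite it.\<close>
    have "I f = 1/4 * (I f + I (\<lambda>(x, y). f (-x, y)) + I (\<lambda>(x, y). f (x, -y)) + I (\<lambda>(x, y). (\<lambda>(x, y). f (x, -y)) (-x, y)))"
      unfolding rx ry by simp
    also have "\<dots> = (\<Sum>a\<in>A. w a * sym_avg f (z a))"
      unfolding I sum.distrib[symmetric] sum_distrib_left
      by (intro sum.cong) (auto simp: sym_avg_def case_prod_beta algebra_simps)
    also have "\<dots> = (\<Sum>a\<in>A. w a * sym_avg f (za a))"
      by (simp add: za_def sym_avg_abs)
    also have "\<dots> = (\<Sum>a\<in>B. w a * sym_avg f (za a))"
      using assms(1) by (intro sum.mono_neutral_right) (auto simp: B_def)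
    also have "\<dots> = (\<Sum>s=1..card B. w (h s) * sym_avg f (za (h s)))"
      by (rule sum.reindex_bij_betw[OF h, symmetric])
    finally show ?thesis .
  qed
  moreover have "w (h s) > 0 \<and> za (h s) \<in> {0..1} \<times> {0..1}" if "s \<in> {1..card B}" for s
  proof -
    have "h s \<in> B" using bij_betwE[OF h] that by blast
    then have "h s \<in> A" "w (h s) \<noteq> 0" by (auto simp: B_def)
    with assms(3,4)[of "h s"] show ?thesis
      by (auto simp: za_def Omega_def mem_Times_iff abs_le_iff)
  qed
  ultimately show ?thesis
    by (intro exI[of _ "card B"] exI[of _ "w \<circ> h"] exI[of _ "za \<circ> h"]) simp
qed

section \<open>Bounds on the boundary weight and the critical polynomial\<close>

lemma bdry_avg_nonneg:
  assumes "p \<in> nonneg_part (Qspace k)" "-1 \<le> \<theta>" "\<theta> \<le> 1"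
  shows "bdry_avg \<theta> p \<ge> 0"
proof -
  have p: "p \<in> Qspace k" "\<And>z. z \<in> Omega \<Longrightarrow> p z \<ge> 0" using assms(1) by (auto simp: nonneg_part_def)
  note int = integrable_section[OF p(1)]
  have "avg_x p \<ge> 0" "avg_y p \<ge> 0"
    unfolding avg_x_def avg_y_def
    by (auto intro!: mult_nonneg_nonneg integral_nonneg integrable_add int add_nonneg_nonneg p(2) simp: Omega_def)
  then show ?thesis using assms(2,3) by (simp add: bdry_avg_def)
qed

text \<open>Weak duality: the reflected nodes stay in \<open>Omega\<close>, so the interior part is
  nonnegative on \<open>p\<close> and may be dropped.\<close>

lemma symmetric_cad_upper_bound:
  assumes "symmetric_cad \<theta> V \<omega>b S \<omega> z" "p \<in> nonneg_part V" "bdry_avg \<theta> p > 0"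
  shows "\<omega>b \<le> avg p / bdry_avg \<theta> p"
proof -
  have "sym_avg p (z s) \<ge> 0" if "s \<in> {1..S}" for s
  proof -
    obtain a b where ab: "z s = (a, b)" by force
    have "z s \<in> {0..1} \<times> {0..1}" using assms(1) that unfolding symmetric_cad_def by blast
    then have "(a, b) \<in> Omega" "(-a, b) \<in> Omega" "(a, -b) \<in> Omega" "(-a, -b) \<in> Omega"
      by (auto simp: Omega_def ab)
    then show ?thesis
      using assms(2) by (simp add: ab sym_avg_def nonneg_part_def)
  qed
  then have "(\<Sum>s=1..S. \<omega> s * sym_avg p (z s)) \<ge> 0"
    using assms(1) by (intro sum_nonneg mult_nonneg_nonneg) (auto simp: symmetric_cad_def intro: less_imp_le)
  moreover have "avg p = \<omega>b * bdry_avg \<theta> p + (\<Sum>s=1..S. \<omega> s * sym_avg p (z s))"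
    using assms(1,2) by (simp add: symmetric_cad_def nonneg_part_def)
  ultimately show ?thesis using assms(3) by (simp add: pos_le_divide_eq)
qed

definition critical :: "nat \<Rightarrow> real \<times> real \<Rightarrow> real" where
  "critical L = (\<lambda>z. poly (pderiv (legendre (L - 1))) (fst z) * poly (pderiv (legendre (L - 1))) (snd z))"

lemma critical_in_Qspace: "critical L \<in> Qspace (L - 2)"
  unfolding critical_def by (intro Qspace_product) (auto simp: degree_pderiv degree_legendre)

lemma classic_interior_critical:
  assumes "L \<ge> 2"
  shows "classic_interior \<theta> L Q (\<lambda>z. (critical L z)\<^sup>2) = 0"
  unfolding classic_interior_def critical_def using GL_nodes(7)[OF assms] by simp

text \<open>The square is symmetric in the two coordinates, so \<open>avg_x\<close> and
  \<open>avg_y\<close> agree and \<open>\<theta>\<close> cancels. The common value is positive since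
  the zeros of \<open>?P\<close> lie strictly inside the interval, whence \<open>poly ?P 1\<close>
  is nonzero.\<close>

lemma bdry_avg_critical_pos:
  assumes "L \<ge> 2"
  shows "bdry_avg \<theta> (\<lambda>z. (critical L z)\<^sup>2) > 0"
proof -
  let ?P = "pderiv (legendre (L - 1))"
  have P: "?P \<noteq> 0" "poly ?P 1 \<noteq> 0"
    using pderiv_legendre_neq_0[of "L - 1"] pderiv_legendre_roots(1)[of "L - 1"] assms by auto
  let ?c = "((poly ?P (-1))\<^sup>2 + (poly ?P 1)\<^sup>2) / 2 * mean (?P * ?P)"
  have "mean (?P * ?P) > 0"
    using P(1) by (intro mean_pos) auto
  moreover have "(poly ?P (-1))\<^sup>2 + (poly ?P 1)\<^sup>2 > 0"
    using P(2) by (intro add_nonneg_pos) auto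
  ultimately have "?c > 0" by simp
  have x: "avg_x (\<lambda>z. (critical L z)\<^sup>2) = ?c"
  proof -
    have "(\<lambda>y. (critical L (-1, y))\<^sup>2 + (critical L (1, y))\<^sup>2)
       = (\<lambda>y. ((poly ?P (-1))\<^sup>2 + (poly ?P 1)\<^sup>2) * poly (?P * ?P) y)"
      by (auto simp: critical_def power2_eq_square algebra_simps)
    then show ?thesis
      by (simp only: avg_x_def mean_def integral_mult_right)
  qed
  have "(\<lambda>z. (critical L z)\<^sup>2) \<circ> prod.swap = (\<lambda>z. (critical L z)\<^sup>2)"
    by (auto simp: critical_def mult.commute)
  then have y: "avg_y (\<lambda>z. (critical L z)\<^sup>2) = ?c"
    using avg_x_swap[of "\<lambda>z. (critical L z)\<^sup>2"] x by simp
  have "bdry_avg \<theta> (\<lambda>z. (critical L z)\<^sup>2) = 2 * ?c"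
    unfolding bdry_avg_def x y distrib_right[symmetric] by simp
  with \<open>?c > 0\<close> show ?thesis by simp
qed

lemma phi_lower_bound:
  assumes p: "p \<in> nonneg_part (Qspace k)" and "L \<ge> 2" "k < 2 * L - 2" "k < 2 * Q" "-1 \<le> \<theta>" "\<theta> \<le> 1"
  shows "phi \<theta> p \<ge> ereal (GL_weight L 1)"
proof (cases "bdry_avg \<theta> p = 0")
  case False
  then have pos: "bdry_avg \<theta> p > 0"
    using bdry_avg_nonneg[OF p assms(5,6)] by simp
  obtain A :: "(nat \<times> nat + nat \<times> nat) set" and w z where
    "finite A" "\<forall>f. classic_interior \<theta> L Q f = (\<Sum>a\<in>A. w a * f (z a))"
    "\<forall>a\<in>A. w a \<ge> 0 \<and> z a \<in> Omega"
    using classic_interior_eq_sum[OF assms(2,5,6), of Q] by (elim exE conjE)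
  then have "classic_interior \<theta> L Q p \<ge> 0"
    using p by (auto intro!: sum_nonneg simp: nonneg_part_def)
  moreover have "avg p = GL_weight L 1 * bdry_avg \<theta> p + classic_interior \<theta> L Q p"
    using p assms by (intro classic_decomposition) (auto simp: nonneg_part_def)
  ultimately show ?thesis
    using pos by (simp add: phi_def pos_le_divide_eq)
qed (simp add: phi_def)

theorem theorem4p1:
  fixes k L Q :: nat and \<theta> :: real
  assumes "k \<ge> 1"
    and "-1 \<le> \<theta>" and "\<theta> \<le> 1"
    and "L = nat \<lceil>(real k + 3) / 2\<rceil>"
    and "real Q \<ge> (real k + 1) / 2"
  shows "(\<forall>p\<in>Qspace k. avg p =
            GL_weight L 1 * ((1 + \<theta>) * avg_x p + (1 - \<theta>) * avg_y p) + classic_interior \<theta> L Q p)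
       \<and> ocad_after_grouping \<theta> (Qspace k) (GL_weight L 1) (classic_interior \<theta> L Q)
       \<and> ereal (omega_star \<theta> (Qspace k)) = phi_star \<theta> (nonneg_part (Qspace k))
       \<and> phi_star \<theta> (nonneg_part (Qspace k)) = phi_star \<theta> (squares (Qspace (k div 2)))
       \<and> phi_star \<theta> (squares (Qspace (k div 2))) = ereal (GL_weight L 1)
       \<and> GL_weight L 1 = 1 / (real L * (real L - 1))
       \<and> (\<exists>q\<in>Qspace (k div 2). q \<noteq> (\<lambda>_. 0) \<and> critical_positive \<theta> (Qspace k) (\<lambda>z. (q z)\<^sup>2))"
proof -
  \<comment> \<open>For \<open>k = 2 * m\<close> the quotient is \<open>m + 3/2\<close>, for
    \<open>k = 2 * m + 1\<close> it is exactly \<open>m + 2\<close>. Hence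
    \<open>L - 2 = k div 2\<close>, the degree bound for \<open>critical L\<close>.\<close>
  have "\<lceil>(real k + 3) / 2\<rceil> = int (k div 2 + 2)"
  proof (cases "even k")
    case True
    then obtain m where "k = 2 * m" by (rule evenE)
    then show ?thesis by (auto intro!: ceiling_unique)
  next
    case False
    then obtain m where "k = 2 * m + 1" by (rule oddE)
    then show ?thesis by (auto intro!: ceiling_unique)
  qed
  then have L: "L = k div 2 + 2" using assms(4) by simp
  then have "L \<ge> 2" "k < 2 * L - 2" by auto
  have "real k < real (2 * Q)" using assms(5) by (simp add: field_simps)
  then have "k < 2 * Q" by (simp only: of_nat_less_iff)
  note LQ = \<open>L \<ge> 2\<close> \<open>k < 2 * L - 2\<close> \<open>k < 2 * Q\<close>
  let ?w = "GL_weight L 1"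
  define r where "r = (\<lambda>z. (critical L z)\<^sup>2)"
  have w: "?w = 1 / (real L * (real L - 1))" by (rule GL_weight_1[OF LQ(1)])
  then have "?w > 0" using LQ(1) by simp
  have dec: "avg p = ?w * bdry_avg \<theta> p + classic_interior \<theta> L Q p" if "p \<in> Qspace k" for p
    using that LQ by (rule classic_decomposition)
  have q: "critical L \<in> Qspace (k div 2)"
    using critical_in_Qspace[of L] L by simp
  have sub: "squares (Qspace (k div 2)) \<subseteq> nonneg_part (Qspace k)"
    by (auto simp: squares_def nonneg_part_def intro!: Qspace_square)
  have r: "r \<in> squares (Qspace (k div 2))" "r \<in> nonneg_part (Qspace k)"
    using q sub by (auto simp: squares_def r_def)
  have bpos: "bdry_avg \<theta> r > 0"
    unfolding r_def by (rule bdry_avg_critical_pos[OF LQ(1)])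
  have avgr: "avg r = ?w * bdry_avg \<theta> r"
    using dec[of r] r(2) classic_interior_critical[OF LQ(1)] by (simp add: r_def nonneg_part_def)
  then have phir: "phi \<theta> r = ereal ?w"
    using bpos by (simp add: phi_def)
  have lower: "ereal ?w \<le> phi \<theta> p" if "p \<in> nonneg_part (Qspace k)" for p
    using that LQ assms(2,3) by (rule phi_lower_bound)
  \<comment> \<open>Stated for any \<open>P\<close> between \<open>{r}\<close> and the nonnegative
    polynomials, this covers both infima, over \<open>nonneg_part\<close> and over
    \<open>squares\<close>.\<close>
  have star: "phi_star \<theta> P = ereal ?w" if "r \<in> P" "P \<subseteq> nonneg_part (Qspace k)" for P
    unfolding phi_star_def using that lower phir
    by (intro antisym) (auto intro!: INF_greatest intro: INF_lower2[of r])
  have upper: "\<omega>b \<le> ?w" if "symmetric_cad \<theta> (Qspace k) \<omega>b S \<omega> z" for \<omega>b S \<omega> z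
    using symmetric_cad_upper_bound[OF that r(2) bpos] avgr bpos by simp
  obtain A :: "(nat \<times> nat + nat \<times> nat) set" and v z where A:
    "finite A" "\<forall>f. classic_interior \<theta> L Q f = (\<Sum>a\<in>A. v a * f (z a))"
    "\<forall>a\<in>A. v a \<ge> 0 \<and> z a \<in> Omega"
    using classic_interior_eq_sum[OF LQ(1) assms(2,3), of Q] by (elim exE conjE)
  have "\<exists>(S :: nat) \<omega> z'. (\<forall>f. classic_interior \<theta> L Q f = (\<Sum>s=1..S. \<omega> s * sym_avg f (z' s))) \<and>
    (\<forall>s\<in>{1..S}. \<omega> s > 0 \<and> z' s \<in> {0..1} \<times> {0..1})"
    using A by (intro symmetric_grouping[of A _ v z] classic_interior_reflect[OF LQ(1)]) auto
  then obtain S :: nat and \<omega> z' where S: "\<forall>f. classic_interior \<theta> L Q f = (\<Sum>s=1..S. \<omega> s * sym_avg f (z' s))"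
    "\<forall>s\<in>{1..S}. \<omega> s > 0 \<and> z' s \<in> {0..1} \<times> {0..1}"
    by (elim exE conjE)
  have cad: "symmetric_cad \<theta> (Qspace k) ?w S \<omega> z'"
    unfolding symmetric_cad_def using \<open>?w > 0\<close> S dec by auto
  have ocad: "ocad_after_grouping \<theta> (Qspace k) ?w (classic_interior \<theta> L Q)"
    unfolding ocad_after_grouping_def ocad_def using S(1) cad upper by blast
  \<comment> \<open>The maximum is attained by \<open>cad\<close>, so \<open>GREATEST\<close>
    denotes a genuine value here.\<close>
  have omega: "omega_star \<theta> (Qspace k) = ?w"
    unfolding omega_star_def using cad upper by (intro Greatest_equality) auto
  have "bdry_avg \<theta> (\<lambda>_. 0) = 0"
    by (simp add: bdry_avg_def avg_x_def avg_y_def)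
  \<comment> \<open>The zero function has boundary average zero, whereas that of \<open>r\<close> is
    positive.\<close>
  then have "r \<noteq> (\<lambda>_. 0)"
    using bpos by force
  moreover from this have "critical L \<noteq> (\<lambda>_. 0)"
    by (auto simp: r_def)
  moreover have "phi \<theta> r = phi_star \<theta> (nonneg_part (Qspace k))"
    using star[OF r(2)] phir by simp
  ultimately have crit: "\<exists>q\<in>Qspace (k div 2). q \<noteq> (\<lambda>_. 0) \<and> critical_positive \<theta> (Qspace k) (\<lambda>z. (q z)\<^sup>2)"
    using q r(2) by (intro bexI[of _ "critical L"]) (auto simp: critical_positive_def r_def)
  show ?thesis
    using dec ocad omega star[OF r(1) sub] star[OF r(2) order.refl] w crit
    by (simp add: bdry_avg_def)
qed

end
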